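(* Let $V$, the $(l,m)$-regular boundary element spaces $S_N=S_h^{l,m}$ ($h=h(N)$) satisfying the inverse property, the collocation sets $\Delta_M=\Delta_{M(N)}$, the discrete inner products $\langle\cdot,\cdot\rangle_M$ and the oversampled collocation approximation $u_N^{(M)}\in S_N$ to the exact solution $u$ be as in the context. Suppose that, for some $r,s>0$ with $\max\{r,s\}<m+\tfrac12-2\alpha$, the quadrature estimate $$|\langle g,f\rangle-\langle g,f\rangle_M|\le \mathcal{E}_{r,s}(\Delta_M)\left(\|f\|_{H^r}\|g\|_{H^s}+\|f\|_{H^s}\|g\|_{H^r}\right)\qquad\text{for all } f,g\in H^{\max\{r,s\}}$$ holds with numbers $\mathcal{E}_{r,s}(\Delta_M)>0$ independent of $f,g$, and that $\Delta_M=\Delta_{M(N)}$ is chosen such that $$\lim_{N\to\infty}\mathcal{E}_{r,s}(\Delta_M)\,h^{-(r+s)}=0 .$$ Then there is a constant $C>0$ independent of $M,N,u$ such that $$\|u_N^{(M)}-u\|_{H^{2\alpha}}\le C\,h^{l-2\alpha}\|u\|_{H^l}.$$ This means the optimal convergence rate in $H^{2\alpha}$ is achieved.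
   Context: **Sobolev spaces.** $H^s=H^s([0,1))$, $s\in\mathbb{R}$, is the space of 1-periodic complex distributions with finite norm $\|f\|_{H^s}=\big(|\hat f_0|^2+\sum_{0\ne n\in\mathbb{Z}}|n|^{2s}|\hat f_n|^2\big)^{1/2}$, $\hat f_n=\int_0^1e^{-2\pi int}f(t)\,dt$. The $L^2$ pairing is $\langle f,g\rangle=\sum_{n\in\mathbb{Z}}\overline{\hat f_n}\hat g_n=\int_0^1\overline{f}g\,dx$. **Operator.** $\alpha\in\mathbb{R}$ and $V$ is a linear operator which for every $s\in\mathbb{R}$ is a continuous isomorphism $V:H^{s+\alpha}\to H^{s-\alpha}$. **Boundary element spaces.** $S_N=S_h^{l,m}\subset H^{m+1/2}$ is a sequence of spaces with $\dim S_N=N$, with parameters $l,m$ and a parameter $h=h(N)>0$ (typically tending to zero along the sequence), such that: (Approximation property, $(l,m)$-regularity) for $t\le s\le l$, $t<m+\frac12$, there is a constant $c$ such that for any $v\in H^s$ there are $\chi_h\in S_h^{l,m}$ with $\|v-\chi_h\|_{H^t}\le c\,h^{s-t}\|v\|_{H^s}$; moreover, for any fixed $\sigma<m+\frac12$, the $\chi_h$ can be chosen so that this holds for all such $t>\sigma$, i.e. independently of $t$. (Inverse property) for $t\le s\le m+\frac12$ there is a constant $C$ such that $\|\chi\|_{H^s}\le C h^{t-s}\|\chi\|_{H^t}$ for all $\chi\in S_h^{l,m}$. **Oversampled collocation.** For each $N$ one chooses $M=M(N)\ge N$ collocation points $\Delta_M=\{0\le x_1<\dots<x_M<1\}$, with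 the periodic convention $x_0=x_M-1$, $x_{M+1}=x_1+1$, and sets $$\langle f,g\rangle_M=\sum_{j=1}^M\frac{x_{j+1}-x_{j-1}}{2}\,\overline{f(x_j)}\,g(x_j).$$ The approximation $u_N^{(M)}\in S_N$ to the exact solution $u$ of $Vu=f$ is the weighted least-squares solution (weights $\frac{x_{j+1}-x_{j-1}}2$) of the collocation equations $Vu_N(x_j)=f(x_j)$, $j=1,\dots,M$; equivalently, $\langle V\chi,Vu_N^{(M)}\rangle_M=\langle V\chi,Vu\rangle_M$ for all $\chi\in S_N$.
   Formalization: The formal statement adds l − 2α > 1/2, so that Vu has point values for every u in H^l (otherwise the bound fails), and asserts the bound for each N at which the least-squares solution is unique, which is proved to hold for all large N. *)

theory Defs
  imports "HOL-Analysis.Analysis"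
begin

section \<open>Periodic distributions\<close>

definition vderiv :: "(real \<Rightarrow> complex) \<Rightarrow> real \<Rightarrow> complex" where
  "vderiv \<phi> = (\<lambda>t. vector_derivative \<phi> (at t))"

text \<open>The test functions: smooth 1-periodic complex functions on the line.\<close>

definition test_functions :: "(real \<Rightarrow> complex) set" where
  "test_functions =
    {\<phi>. (\<forall>t. \<phi> (t + 1) = \<phi> t) \<and> (\<forall>k t. (vderiv ^^ k) \<phi> differentiable (at t))}"

definition test_seminorm :: "nat \<Rightarrow> (real \<Rightarrow> complex) \<Rightarrow> real" where
  "test_seminorm k \<phi> = (\<Sum>j\<le>k. SUP t\<in>{0..1}. cmod ((vderiv ^^ j) \<phi> t))"

lemma test_seminorm_mono:
  assumes "\<phi> \<in> test_functions" "k \<le> k'"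
  shows "0 \<le> test_seminorm k \<phi>" "test_seminorm k \<phi> \<le> test_seminorm k' \<phi>"
proof -
  have nn: "0 \<le> (SUP t\<in>{0..1}. cmod ((vderiv ^^ j) \<phi> t))" for j
  proof -
    have "continuous_on {0..1} ((vderiv ^^ j) \<phi>)"
      using assms(1)
      by (auto simp: test_functions_def intro!: continuous_at_imp_continuous_on differentiable_imp_continuous_within)
    then have "continuous_on {0..1} (\<lambda>t. cmod ((vderiv ^^ j) \<phi> t))"
      by (intro continuous_intros)
    then have "compact ((\<lambda>t. cmod ((vderiv ^^ j) \<phi> t)) ` {0..1})"
      by (rule compact_continuous_image) simp
    then have "bdd_above ((\<lambda>t. cmod ((vderiv ^^ j) \<phi> t)) ` {0..1})"
      by (intro bounded_imp_bdd_above compact_imp_bounded)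
    then have "cmod ((vderiv ^^ j) \<phi> 0) \<le> (SUP t\<in>{0..1}. cmod ((vderiv ^^ j) \<phi> t))"
      by (rule cSUP_upper[rotated]) simp
    then show ?thesis
      using norm_ge_zero order_trans by blast
  qed
  show "0 \<le> test_seminorm k \<phi>"
    unfolding test_seminorm_def by (intro sum_nonneg nn)
  show "test_seminorm k \<phi> \<le> test_seminorm k' \<phi>"
    unfolding test_seminorm_def using assms(2) by (intro sum_mono2) (auto intro: nn)
qed

text \<open>A 1-periodic distribution is a linear functional on the test functions that is continuous
  for their Frechet topology, i.e. bounded by one of the seminorms. The value \<open>0\<close> outside the test
  functions only serves to make the representation as a total function unique.\<close>

typedef pdist = "{T :: (real \<Rightarrow> complex) \<Rightarrow> complex.
    (\<forall>\<phi>. \<phi> \<notin> test_functions \<longrightarrow> T \<phi> = 0) \<and>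
    (\<forall>\<phi>\<in>test_functions. \<forall>\<psi>\<in>test_functions. T (\<lambda>t. \<phi> t + \<psi> t) = T \<phi> + T \<psi>) \<and>
    (\<forall>c. \<forall>\<phi>\<in>test_functions. T (\<lambda>t. c * \<phi> t) = c * T \<phi>) \<and>
    (\<exists>k C. \<forall>\<phi>\<in>test_functions. cmod (T \<phi>) \<le> C * test_seminorm k \<phi>)}"
  morphisms dist_apply Abs_pdist
  by (rule exI[of _ "\<lambda>_. 0"]) (auto intro!: exI[of _ 0])

setup_lifting type_definition_pdist

lemma bounded_functional_combine:
  fixes T U :: "(real \<Rightarrow> complex) \<Rightarrow> complex"
  assumes "\<exists>k C. \<forall>\<phi>\<in>test_functions. cmod (T \<phi>) \<le> C * test_seminorm k \<phi>"
    and "\<exists>k C. \<forall>\<phi>\<in>test_functions. cmod (U \<phi>) \<le> C * test_seminorm k \<phi>"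
  shows "\<exists>k C. \<forall>\<phi>\<in>test_functions. cmod (a * T \<phi> + b * U \<phi>) \<le> C * test_seminorm k \<phi>"
proof -
  obtain k C k' C' where
    T: "\<And>\<phi>. \<phi> \<in> test_functions \<Longrightarrow> cmod (T \<phi>) \<le> C * test_seminorm k \<phi>" and
    U: "\<And>\<phi>. \<phi> \<in> test_functions \<Longrightarrow> cmod (U \<phi>) \<le> C' * test_seminorm k' \<phi>"
    using assms by blast
  have step: "D * test_seminorm i \<phi> \<le> \<bar>D\<bar> * test_seminorm (max k k') \<phi>"
    if "\<phi> \<in> test_functions" "i \<le> max k k'" for D i \<phi>
    using test_seminorm_mono[OF that] by (intro mult_mono) auto
  show ?thesis
  proof (intro exI ballI)
    fix \<phi> assume \<phi>: "\<phi> \<in> test_functions"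
    have "cmod (a * T \<phi> + b * U \<phi>) \<le> cmod a * cmod (T \<phi>) + cmod b * cmod (U \<phi>)"
      by (metis norm_mult norm_triangle_ineq)
    also have "\<dots> \<le> cmod a * (\<bar>C\<bar> * test_seminorm (max k k') \<phi>)
        + cmod b * (\<bar>C'\<bar> * test_seminorm (max k k') \<phi>)"
      using T[OF \<phi>] U[OF \<phi>] step[OF \<phi>, of k C] step[OF \<phi>, of k' C']
      by (intro add_mono mult_left_mono) auto
    finally show "cmod (a * T \<phi> + b * U \<phi>)
        \<le> (cmod a * \<bar>C\<bar> + cmod b * \<bar>C'\<bar>) * test_seminorm (max k k') \<phi>"
      by (simp add: algebra_simps)
  qed
qed

instantiation pdist :: ab_group_add
begin

lift_definition zero_pdist :: pdist is "\<lambda>_. 0"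
  by (auto intro!: exI[of _ 0])

lift_definition plus_pdist :: "pdist \<Rightarrow> pdist \<Rightarrow> pdist" is "\<lambda>T U \<phi>. T \<phi> + U \<phi>"
  subgoal for T U
    using bounded_functional_combine[of T U 1 1] by (auto simp: algebra_simps)
  done

lift_definition minus_pdist :: "pdist \<Rightarrow> pdist \<Rightarrow> pdist" is "\<lambda>T U \<phi>. T \<phi> - U \<phi>"
  subgoal for T U
    using bounded_functional_combine[of T U 1 "-1"] by (auto simp: algebra_simps)
  done

lift_definition uminus_pdist :: "pdist \<Rightarrow> pdist" is "\<lambda>T \<phi>. - T \<phi>"
  subgoal for T
    using bounded_functional_combine[of T T "-1" 0] by (auto simp: algebra_simps)
  done

instance
  by standard (transfer; simp add: fun_eq_iff)+

end

lift_definition pscale :: "complex \<Rightarrow> pdist \<Rightarrow> pdist" is "\<lambda>c T \<phi>. c * T \<phi>"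
  subgoal for c T
    using bounded_functional_combine[of T T c 0] by (auto simp: algebra_simps)
  done

interpretation pdist: vector_space pscale
  by standard (transfer; simp add: fun_eq_iff algebra_simps)+

section \<open>Sobolev spaces\<close>

definition fourier_coeff :: "pdist \<Rightarrow> int \<Rightarrow> complex" where
  "fourier_coeff f n = dist_apply f (\<lambda>t. cis (- (2 * pi * of_int n * t)))"

definition sobolev_space :: "real \<Rightarrow> pdist set" where
  "sobolev_space s =
    {f. (\<lambda>n. \<bar>of_int n\<bar> powr (2 * s) * (cmod (fourier_coeff f n))\<^sup>2) summable_on - {0}}"

definition sobolev_norm :: "real \<Rightarrow> pdist \<Rightarrow> real" where
  "sobolev_norm s f = sqrt ((cmod (fourier_coeff f 0))\<^sup>2 +
     (\<Sum>\<^sub>\<infinity>n\<in>- {0}. \<bar>of_int n\<bar> powr (2 * s) * (cmod (fourier_coeff f n))\<^sup>2))"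

definition l2_pairing :: "pdist \<Rightarrow> pdist \<Rightarrow> complex" where
  "l2_pairing f g = (\<Sum>\<^sub>\<infinity>n. cnj (fourier_coeff f n) * fourier_coeff g n)"

text \<open>Continuous isomorphism means a bijection that is bounded in both directions.\<close>

definition sobolev_isomorphism :: "real \<Rightarrow> (pdist \<Rightarrow> pdist) \<Rightarrow> bool" where
  "sobolev_isomorphism \<alpha> V \<longleftrightarrow>
    Vector_Spaces.linear pscale pscale V \<and>
    (\<forall>s. bij_betw V (sobolev_space (s + \<alpha>)) (sobolev_space (s - \<alpha>)) \<and>
      (\<exists>c. \<forall>u\<in>sobolev_space (s + \<alpha>). sobolev_norm (s - \<alpha>) (V u) \<le> c * sobolev_norm (s + \<alpha>) u) \<and>
      (\<exists>c. \<forall>u\<in>sobolev_space (s + \<alpha>). sobolev_norm (s + \<alpha>) u \<le> c * sobolev_norm (s - \<alpha>) (V u)))"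

section \<open>Point values\<close>

definition represents :: "(real \<Rightarrow> complex) \<Rightarrow> pdist \<Rightarrow> bool" where
  "represents F f \<longleftrightarrow> continuous_on UNIV F \<and> (\<forall>t. F (t + 1) = F t) \<and>
     (\<forall>\<phi>\<in>test_functions. dist_apply f \<phi> = integral {0..1} (\<lambda>t. F t * \<phi> t))"

text \<open>The values of the continuous representative; unspecified for a distribution without one.\<close>

definition point_value :: "pdist \<Rightarrow> real \<Rightarrow> complex" where
  "point_value f = (THE F. represents F f)"

section \<open>Boundary element spaces\<close>

text \<open>In all families indexed by the dimension \<open>N\<close> only the indices \<open>N \<ge> 1\<close> matter.\<close>

definition boundary_element_spaces :: "real \<Rightarrow> (nat \<Rightarrow> real) \<Rightarrow> (nat \<Rightarrow> pdist set) \<Rightarrow> bool" where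
  "boundary_element_spaces m h S \<longleftrightarrow>
    (\<forall>N\<ge>1. h N > 0 \<and> pdist.subspace (S N) \<and> pdist.dim (S N) = N \<and>
       S N \<subseteq> sobolev_space (m + 1/2))"

text \<open>In the second part one element \<open>w\<close> serves all \<open>t > \<sigma>\<close> at once; the constant may still depend
  on \<open>t\<close>.\<close>

definition approximation_property ::
    "real \<Rightarrow> real \<Rightarrow> (nat \<Rightarrow> real) \<Rightarrow> (nat \<Rightarrow> pdist set) \<Rightarrow> bool" where
  "approximation_property l m h S \<longleftrightarrow>
    (\<forall>t s. t \<le> s \<and> s \<le> l \<and> t < m + 1/2 \<longrightarrow>
      (\<exists>c. \<forall>N\<ge>1. \<forall>v\<in>sobolev_space s. \<exists>w\<in>S N.
        sobolev_norm t (v - w) \<le> c * h N powr (s - t) * sobolev_norm s v)) \<and>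
    (\<forall>\<sigma> s. \<sigma> < m + 1/2 \<and> s \<le> l \<longrightarrow>
      (\<exists>c :: real \<Rightarrow> real. \<forall>N\<ge>1. \<forall>v\<in>sobolev_space s. \<exists>w\<in>S N.
        \<forall>t. \<sigma> < t \<and> t \<le> s \<and> t < m + 1/2 \<longrightarrow>
          sobolev_norm t (v - w) \<le> c t * h N powr (s - t) * sobolev_norm s v))"

definition inverse_property :: "real \<Rightarrow> (nat \<Rightarrow> real) \<Rightarrow> (nat \<Rightarrow> pdist set) \<Rightarrow> bool" where
  "inverse_property m h S \<longleftrightarrow>
    (\<forall>t s. t \<le> s \<and> s \<le> m + 1/2 \<longrightarrow>
      (\<exists>C. \<forall>N\<ge>1. \<forall>w\<in>S N. sobolev_norm s w \<le> C * h N powr (t - s) * sobolev_norm t w))"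

section \<open>Oversampled collocation\<close>

text \<open>The points are \<open>x 1, \<dots>, x M\<close>; \<open>x 0\<close> and \<open>x (M + 1)\<close> are their periodic neighbours.\<close>

definition collocation_points :: "nat \<Rightarrow> (nat \<Rightarrow> real) \<Rightarrow> bool" where
  "collocation_points M x \<longleftrightarrow>
    0 \<le> x 1 \<and> strict_mono_on {1..M} x \<and> x M < 1 \<and> x 0 = x M - 1 \<and> x (M + 1) = x 1 + 1"

definition discrete_pairing :: "nat \<Rightarrow> (nat \<Rightarrow> real) \<Rightarrow> pdist \<Rightarrow> pdist \<Rightarrow> complex" where
  "discrete_pairing M x f g =
    (\<Sum>j=1..M. of_real ((x (j + 1) - x (j - 1)) / 2) * cnj (point_value f (x j)) * point_value g (x j))"

definition collocation_error ::
    "(pdist \<Rightarrow> pdist) \<Rightarrow> nat \<Rightarrow> (nat \<Rightarrow> real) \<Rightarrow> pdist \<Rightarrow> pdist \<Rightarrow> real" where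
  "collocation_error V M x f v =
    (\<Sum>j=1..M. (x (j + 1) - x (j - 1)) / 2 * (cmod (point_value (V v) (x j) - point_value f (x j)))\<^sup>2)"

text \<open>Weighted least-squares solution in \<open>S\<close> of the equations \<open>V v (x j) = f (x j)\<close>.\<close>

definition least_squares_collocation ::
    "(pdist \<Rightarrow> pdist) \<Rightarrow> pdist set \<Rightarrow> nat \<Rightarrow> (nat \<Rightarrow> real) \<Rightarrow> pdist \<Rightarrow> pdist \<Rightarrow> bool" where
  "least_squares_collocation V S M x f v \<longleftrightarrow>
    v \<in> S \<and> (\<forall>w\<in>S. collocation_error V M x f v \<le> collocation_error V M x f w)"

end

theory Submission
  imports Defs
begin

text \<open>The error \<open>V u\<^sub>N - V u\<close> is compared with \<open>V \<chi> - V u\<close> for an approximant \<open>\<chi>\<close> of \<open>u\<close>.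
  The quadrature estimate and the inverse property show that the discrete norm is bounded below by the
  \<open>L\<^sup>2\<close> norm on \<open>V S\<^sub>N\<close> for large \<open>N\<close>, so quasi-optimality in the discrete norm reduces everything to
  bounding the discrete norm of \<open>V \<chi> - V u\<close>. Since \<open>V u\<close> need not lie in \<open>H\<^bsup>max r s\<^esup>\<close>, the quadrature
  estimate is not applied to it directly but only to trigonometric polynomials of degree below
  \<open>L \<approx> 1/h\<close>. Multiplication by \<open>e\<^bsub>kL\<^esub>\<close> leaves moduli of point values unchanged, so splitting the
  frequencies of \<open>f \<in> H\<^bsup>\<sigma>\<^esup>\<close>, \<open>\<sigma> > 1/2\<close>, into blocks of length \<open>L\<close> and applying Cauchy-Schwarz over the
  blocks bounds the discrete norm of \<open>f\<close> by \<open>\<parallel>f\<parallel>\<^sub>0 + h\<^bsup>\<sigma>\<^esup> \<parallel>f\<parallel>\<^sub>\<sigma>\<close>. For the remaining finitely many \<open>N\<close>,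
  uniqueness of the least-squares solution makes the discrete norm definite on the finite-dimensional
  space \<open>V S\<^sub>N\<close>.\<close>

section \<open>Fourier analysis of test functions and distributions\<close>

text \<open>Smoothness is limited on two sides: V u lies in H^(l - 2\<alpha>) and V
  \<open>S N\<close> in H^(m + 1/2 - 2\<alpha>). The exponent \<sigma> = min (l - 2\<alpha>) (max r
  s) serves both, provided it exceeds 1/2, which point values and the sum of |k|^(-2\<sigma>) over
  the blocks require. For max r s this bound is extracted from the quadrature estimate itself. The
  degree 1/h balances two errors. On frequencies in [0, L) the quadrature estimate costs a multiple
  of \<E> L^(r + s) times the squared L^2 norm, bounded as long as L is at most a multiple of 1/h.
  The higher blocks cost L^(-\<sigma>), at most h^\<sigma>, in front of the H^\<sigma> norm, and
  h^\<sigma> is exactly what the approximation error loses in passing from the H^(2\<alpha>) norm to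
  the H^(\<sigma> + 2\<alpha>) norm. Rounding 1/h up to an integer is harmless because the inverse
  property bounds h from above. For a small N the constant obtained from uniqueness concerns
  \<open>S N\<close> alone and not the u for which uniqueness is known, so finitely many constants
  have to be compared.\<close>

definition fexp :: "int \<Rightarrow> real \<Rightarrow> complex" where
  "fexp n t = cis (2 * pi * of_int n * t)"

lemma norm_fexp [simp]: "cmod (fexp n t) = 1"
  by (simp add: fexp_def)

lemma fexp_0 [simp]: "fexp 0 t = 1"
  by (simp add: fexp_def)

lemma fexp_add: "fexp (m + n) t = fexp m t * fexp n t"
  by (simp add: fexp_def cis_mult algebra_simps)

lemma cnj_fexp: "cnj (fexp n t) = fexp (- n) t"
  by (simp add: fexp_def cis_cnj)

lemma fexp_inverse [simp]: "fexp (- n) t * fexp n t = 1"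
  by (simp flip: fexp_add)

lemma fexp_periodic: "fexp n (t + 1) = fexp n t"
proof -
  have "fexp n (t + 1) = fexp n t * cis (2 * pi * of_int n)"
    by (simp add: fexp_def cis_mult algebra_simps)
  also have "cis (2 * pi * of_int n) = 1"
    by (rule cis_multiple_2pi) auto
  finally show ?thesis by simp
qed

lemma has_vector_derivative_fexp:
  "(fexp n has_vector_derivative 2 * pi * \<i> * of_int n * fexp n t) (at t within A)"
proof -
  have "((\<lambda>z. exp (2 * pi * \<i> * of_int n * z)) has_field_derivative
      2 * pi * \<i> * of_int n * exp (2 * pi * \<i> * of_int n * of_real t)) (at (of_real t))"
    by (auto intro!: derivative_eq_intros)
  then have "((\<lambda>t. exp (2 * pi * \<i> * of_int n * of_real t)) has_vector_derivative
      2 * pi * \<i> * of_int n * exp (2 * pi * \<i> * of_int n * of_real t)) (at t within A)"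
    by (rule has_vector_derivative_real_field)
  then show ?thesis
    by (simp add: fexp_def [abs_def] cis_conv_exp mult_ac)
qed

lemma continuous_on_fexp [continuous_intros]: "continuous_on A (fexp n)"
  by (intro continuous_at_imp_continuous_on ballI has_vector_derivative_continuous[OF has_vector_derivative_fexp])

lemma vderiv_fexp: "vderiv (\<lambda>t. c * fexp n t) = (\<lambda>t. (2 * pi * \<i> * of_int n * c) * fexp n t)"
  unfolding vderiv_def
  by (rule ext, rule vector_derivative_at)
     (auto intro!: derivative_eq_intros has_vector_derivative_fexp)

lemma vderiv_pow_fexp:
  "(vderiv ^^ k) (\<lambda>t. c * fexp n t) = (\<lambda>t. (2 * pi * \<i> * of_int n) ^ k * c * fexp n t)"
proof (induction k)
  case (Suc k)
  then show ?case
    using vderiv_fexp[of "(2 * pi * \<i> * of_int n) ^ k * c" n] by (simp add: mult_ac)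
qed auto

lemma fexp_test_function: "(\<lambda>t. c * fexp n t) \<in> test_functions"
  unfolding test_functions_def
proof (safe, goal_cases)
  case (1 t)
  show ?case by (simp add: fexp_periodic)
next
  case (2 k t)
  show ?case
    unfolding vderiv_pow_fexp
    by (intro differentiableI_vector[OF has_vector_derivative_mult_right[OF has_vector_derivative_fexp]])
qed

lemma fexp_in_test_functions [simp]: "fexp n \<in> test_functions"
  using fexp_test_function[of 1 n] by (simp flip: fun_eq_iff)

section \<open>Derivatives and linear combinations of test functions\<close>

lemma test_function_periodic: "\<phi> \<in> test_functions \<Longrightarrow> \<phi> (t + 1) = \<phi> t"
  by (simp add: test_functions_def)

lemma test_function_vderiv_pow_differentiable:
  "\<phi> \<in> test_functions \<Longrightarrow> (vderiv ^^ k) \<phi> differentiable (at t)"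
  by (simp add: test_functions_def)

lemma test_function_has_vector_derivative:
  "\<phi> \<in> test_functions \<Longrightarrow> (\<phi> has_vector_derivative vderiv \<phi> t) (at t within A)"
  using test_function_vderiv_pow_differentiable[of \<phi> 0 t]
  by (simp add: vderiv_def vector_derivative_works has_vector_derivative_at_within)

lemma vderiv_test_function:
  assumes "\<phi> \<in> test_functions"
  shows "vderiv \<phi> \<in> test_functions"
proof -
  have "vderiv \<phi> (t + 1) = vderiv \<phi> t" for t
  proof -
    have "(\<phi> \<circ> (\<lambda>t. t + 1) has_vector_derivative 1 *\<^sub>R vderiv \<phi> (t + 1)) (at t)"
      by (rule vector_diff_chain_at)
         (auto intro!: derivative_eq_intros test_function_has_vector_derivative assms)
    also have "\<phi> \<circ> (\<lambda>t. t + 1) = \<phi>"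
      using test_function_periodic[OF assms] by auto
    finally show ?thesis
      by (simp add: vderiv_def vector_derivative_at)
  qed
  moreover have "(vderiv ^^ k) (vderiv \<phi>) differentiable (at t)" for k t
    using test_function_vderiv_pow_differentiable[OF assms, of "Suc k"]
    by (simp add: funpow_swap1)
  ultimately show ?thesis
    unfolding test_functions_def by auto
qed

lemma vderiv_pow_test_function:
  "\<phi> \<in> test_functions \<Longrightarrow> (vderiv ^^ k) \<phi> \<in> test_functions"
  by (induction k) (auto intro: vderiv_test_function)

lemma continuous_on_test_function: "\<phi> \<in> test_functions \<Longrightarrow> continuous_on A \<phi>"
  by (intro continuous_at_imp_continuous_on ballI
      has_vector_derivative_continuous[OF test_function_has_vector_derivative])

lemma vderiv_pow_add:
  assumes "\<phi> \<in> test_functions" "\<psi> \<in> test_functions"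
  shows "(vderiv ^^ k) (\<lambda>t. \<phi> t + c * \<psi> t) = (\<lambda>t. (vderiv ^^ k) \<phi> t + c * (vderiv ^^ k) \<psi> t)"
proof (induction k)
  case (Suc k)
  have "vderiv (\<lambda>t. (vderiv ^^ k) \<phi> t + c * (vderiv ^^ k) \<psi> t) =
      (\<lambda>t. vderiv ((vderiv ^^ k) \<phi>) t + c * vderiv ((vderiv ^^ k) \<psi>) t)"
    unfolding vderiv_def[of "\<lambda>t. (vderiv ^^ k) \<phi> t + c * (vderiv ^^ k) \<psi> t"]
    by (rule ext, rule vector_derivative_at)
       (auto intro!: derivative_eq_intros test_function_has_vector_derivative
         vderiv_pow_test_function assms)
  with Suc show ?case by simp
qed auto

lemma test_functions_add:
  assumes "\<phi> \<in> test_functions" "\<psi> \<in> test_functions"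
  shows "(\<lambda>t. \<phi> t + c * \<psi> t) \<in> test_functions"
  unfolding test_functions_def
proof (safe, goal_cases)
  case (1 t)
  show ?case using assms by (simp add: test_function_periodic)
next
  case (2 k t)
  show ?case
    unfolding vderiv_pow_add[OF assms]
    by (intro derivative_intros test_function_vderiv_pow_differentiable assms)
qed

text \<open>Both claims share one induction because the derivative formula for a larger sum needs
  the smaller sum to be a test function already.\<close>

lemma test_functions_sum_fexp:
  assumes "finite A"
  shows "(\<lambda>t. \<Sum>n\<in>A. c n * fexp n t) \<in> test_functions \<and>
    (vderiv ^^ k) (\<lambda>t. \<Sum>n\<in>A. c n * fexp n t) = (\<lambda>t. \<Sum>n\<in>A. (2 * pi * \<i> * of_int n) ^ k * c n * fexp n t)"
  using assms
proof (induction A)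
  case empty
  then show ?case using fexp_test_function[of 0 0] vderiv_pow_fexp[of k 0 0] by simp
next
  case (insert m A)
  have "(\<lambda>t. \<Sum>n\<in>insert m A. c n * fexp n t) = (\<lambda>t. (\<Sum>n\<in>A. c n * fexp n t) + c m * fexp m t)"
    using insert by (simp add: add.commute)
  moreover have "(vderiv ^^ k) (fexp m) = (\<lambda>t. (2 * pi * \<i> * of_int m) ^ k * fexp m t)"
    using vderiv_pow_fexp[of k 1 m] by (simp flip: fun_eq_iff)
  ultimately show ?case
    using insert test_functions_add[of "\<lambda>t. \<Sum>n\<in>A. c n * fexp n t" "fexp m" "c m"]
      vderiv_pow_add[of "\<lambda>t. \<Sum>n\<in>A. c n * fexp n t" "fexp m" k "c m"]
    by (simp add: algebra_simps)
qed

subsection \<open>Fourier coefficients of functions\<close>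

definition fhat :: "(real \<Rightarrow> complex) \<Rightarrow> int \<Rightarrow> complex" where
  "fhat F n = integral {0..1} (\<lambda>t. F t * fexp (- n) t)"

lemma integral_fexp: "integral {0..1} (fexp n) = (if n = 0 then 1 else 0)"
proof (cases "n = 0")
  case False
  have "((\<lambda>t. fexp n t / (2 * pi * \<i> * of_int n)) has_vector_derivative fexp n t) (at t within {0..1})" for t
    using False
    by (auto intro!: derivative_eq_intros has_vector_derivative_fexp)
  then have "(fexp n has_integral fexp n 1 / (2 * pi * \<i> * of_int n) - fexp n 0 / (2 * pi * \<i> * of_int n)) {0..1}"
    by (intro fundamental_theorem_of_calculus) auto
  then show ?thesis
    using False fexp_periodic[of n 0] by (simp add: integral_unique)
qed (simp add: fexp_def[abs_def])

text \<open>Integration by parts; the boundary terms cancel since \<open>\<phi>\<close> and the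
  exponential are 1-periodic.\<close>

lemma fhat_vderiv:
  assumes "\<phi> \<in> test_functions"
  shows "fhat (vderiv \<phi>) n = 2 * pi * \<i> * of_int n * fhat \<phi> n"
proof -
  have d: "((\<lambda>t. \<phi> t * fexp (- n) t) has_vector_derivative
      vderiv \<phi> t * fexp (- n) t - 2 * pi * \<i> * of_int n * (\<phi> t * fexp (- n) t)) (at t within {0..1})" for t
    by (auto intro!: derivative_eq_intros has_vector_derivative_fexp test_function_has_vector_derivative assms
        simp: algebra_simps)
  define c where "c = 2 * pi * \<i> * of_int n"
  have "((\<lambda>t. vderiv \<phi> t * fexp (- n) t - c * (\<phi> t * fexp (- n) t)) has_integral
      \<phi> 1 * fexp (- n) 1 - \<phi> 0 * fexp (- n) 0) {0..1}"
    unfolding c_def by (intro fundamental_theorem_of_calculus d) auto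
  moreover have "\<phi> 1 * fexp (- n) 1 - \<phi> 0 * fexp (- n) 0 = 0"
    using fexp_periodic[of "- n" 0] test_function_periodic[OF assms, of 0] by simp
  ultimately have 0: "integral {0..1} (\<lambda>t. vderiv \<phi> t * fexp (- n) t - c * (\<phi> t * fexp (- n) t)) = 0"
    by (simp add: integral_unique)
  have i1: "(\<lambda>t. vderiv \<phi> t * fexp (- n) t) integrable_on {0..1}"
    and i2: "(\<lambda>t. \<phi> t * fexp (- n) t) integrable_on {0..1}"
    by (intro integrable_continuous_interval continuous_intros continuous_on_test_function vderiv_test_function assms)+
  have "integral {0..1} (\<lambda>t. vderiv \<phi> t * fexp (- n) t) = c * integral {0..1} (\<lambda>t. \<phi> t * fexp (- n) t)"
    using 0 integral_diff[OF i1 integrable_on_mult_right[OF i2, of c]]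
      integral_mult_right[of "{0..1}" c "\<lambda>t. \<phi> t * fexp (- n) t"] by simp
  then show ?thesis
    by (simp only: fhat_def c_def)
qed

lemma fhat_vderiv_pow:
  "\<phi> \<in> test_functions \<Longrightarrow> fhat ((vderiv ^^ k) \<phi>) n = (2 * pi * \<i> * of_int n) ^ k * fhat \<phi> n"
  by (induction k) (auto simp: fhat_vderiv vderiv_pow_test_function)

lemma norm_fhat_le:
  assumes "continuous_on {0..1} F" "\<And>t. t \<in> {0..1} \<Longrightarrow> cmod (F t) \<le> B"
  shows "cmod (fhat F n) \<le> B"
proof -
  have "cmod (fhat F n) \<le> B * (1 - 0)"
    unfolding fhat_def
    by (rule integral_bound) (auto intro!: continuous_intros assms simp: norm_mult assms)
  then show ?thesis by simp
qed

text \<open>At \<open>n = 0\<close> this is \<open>1\<close>, so that the separate term \<open>n = 0\<close> of the Sobolev norms needs no case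
  distinction.\<close>

definition bracket :: "int \<Rightarrow> real" where "bracket n = max 1 \<bar>of_int n\<bar>"

lemma bracket_ge_1 [simp]: "bracket n \<ge> 1" and bracket_pos [simp]: "bracket n > 0" and bracket_nonneg [simp]: "bracket n \<ge> 0"
  by (auto simp: bracket_def)

lemma summable_on_int:
  fixes f :: "int \<Rightarrow> real"
  assumes "(\<lambda>n. f (int n)) summable_on UNIV" "(\<lambda>n. f (- int n)) summable_on UNIV"
  shows "f summable_on UNIV"
proof -
  have 1: "f summable_on range int"
    using assms(1) by (subst summable_on_reindex) (auto simp: o_def)
  have "f summable_on range (\<lambda>n. - int n)"
    using assms(2) by (subst summable_on_reindex) (auto simp: o_def inj_on_def)
  then have 2: "f summable_on (range (\<lambda>n. - int n) - range int)"
    by (rule summable_on_subset_banach) auto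
  have "f summable_on (range int \<union> (range (\<lambda>n. - int n) - range int))"
    by (intro summable_on_Un_disjoint 1 2) auto
  also have "range int \<union> (range (\<lambda>n. - int n) - range int) = UNIV"
    using int_cases2 by blast
  finally show ?thesis .
qed

lemma summable_bracket:
  assumes "a > 1"
  shows "(\<lambda>n. bracket n powr (- a)) summable_on UNIV"
proof -
  have "summable (\<lambda>n. real n powr (- a))"
    using assms by (simp add: summable_real_powr_iff)
  then have "summable (\<lambda>n. bracket (int n) powr (- a))"
    by (subst summable_cong[where g="\<lambda>n. real n powr (- a)"])
       (auto simp: bracket_def max_def intro!: eventually_mono[OF eventually_gt_at_top[of 0]])
  then have "(\<lambda>n. bracket (int n) powr (- a)) summable_on UNIV"
    by (intro summable_nonneg_imp_summable_on) auto
  then show ?thesis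
    by (intro summable_on_int) (auto simp: bracket_def)
qed

text \<open>Two derivatives give decay of order n^(-2) by \<open>fhat_vderiv_pow\<close>; the bound
  for \<open>\<phi>\<close> itself covers |n| \<le> 1, where \<open>bracket n = 1\<close>.\<close>

lemma summable_fhat:
  assumes "\<phi> \<in> test_functions"
  shows "(\<lambda>n. cmod (fhat \<phi> n)) summable_on UNIV"
proof -
  have bdd: "\<exists>B. \<forall>t\<in>{0..1}. cmod (F t) \<le> B" if "F \<in> test_functions" for F
  proof -
    have "bounded (F ` {0..1})"
      by (intro compact_imp_bounded compact_continuous_image continuous_on_test_function that) auto
    then show ?thesis by (auto simp: bounded_iff)
  qed
  obtain B0 where B0: "\<And>t. t \<in> {0..1} \<Longrightarrow> cmod (\<phi> t) \<le> B0" using bdd[OF assms] by blast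
  obtain B2 where B2: "\<And>t. t \<in> {0..1} \<Longrightarrow> cmod ((vderiv ^^ 2) \<phi> t) \<le> B2"
    using bdd[OF vderiv_pow_test_function[OF assms]] by blast
  have 0: "cmod (fhat \<phi> n) \<le> B0" for n
    by (rule norm_fhat_le) (auto intro: continuous_on_test_function assms B0)
  have 2: "cmod (fhat \<phi> n) * (of_int n)\<^sup>2 \<le> B2" for n
  proof -
    have "(of_int n)\<^sup>2 * 1 \<le> (of_int n)\<^sup>2 * (2 * pi)\<^sup>2"
      using pi_ge_two by (intro mult_left_mono one_le_power) auto
    then have "cmod (fhat \<phi> n) * (of_int n)\<^sup>2 \<le> cmod (fhat \<phi> n) * ((2 * pi)\<^sup>2 * (of_int n)\<^sup>2)"
      by (intro mult_left_mono) (auto simp: mult_ac)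
    also have "\<dots> = cmod ((2 * pi * \<i> * of_int n) ^ 2 * fhat \<phi> n)"
      by (simp add: norm_mult norm_power power_mult_distrib mult_ac)
    also have "\<dots> = cmod (fhat ((vderiv ^^ 2) \<phi>) n)"
      using fhat_vderiv_pow[OF assms, of 2 n] by simp
    also have "\<dots> \<le> B2"
      by (rule norm_fhat_le) (auto intro: continuous_on_test_function vderiv_pow_test_function assms B2)
    finally show ?thesis .
  qed
  have "cmod (fhat \<phi> n) \<le> max B0 B2 * bracket n powr (- 2)" for n
  proof -
    have "cmod (fhat \<phi> n) * (bracket n)\<^sup>2 \<le> max B0 B2"
    proof (cases "\<bar>real_of_int n\<bar> \<le> 1")
      case True
      then show ?thesis using 0[of n] by (simp add: bracket_def max_def)
    next
      case False
      then show ?thesis using 2[of n] by (simp add: bracket_def max_def)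
    qed
    then show ?thesis
      using zero_less_power[OF bracket_pos[of n], of 2]
      by (simp add: powr_minus powr_numeral pos_le_divide_eq flip: divide_inverse)
  qed
  moreover have "(\<lambda>n. max B0 B2 * bracket n powr (- 2)) summable_on UNIV"
    by (intro summable_on_cmult_right summable_bracket) auto
  ultimately show ?thesis
    using Infinite_Sum.abs_summable_on_comparison_test'[of "\<lambda>n. max B0 B2 * bracket n powr (- 2)" UNIV "fhat \<phi>"] by blast
qed

subsection \<open>Uniqueness of Fourier coefficients\<close>

text \<open>Trigonometric polynomials. Generation by rules lets closure under products and
  orthogonality be checked generator by generator.\<close>

inductive_set trig :: "(real \<Rightarrow> complex) set" where
  fexp: "fexp n \<in> trig"
| scale: "p \<in> trig \<Longrightarrow> (\<lambda>t. c * p t) \<in> trig"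
| add: "p \<in> trig \<Longrightarrow> q \<in> trig \<Longrightarrow> (\<lambda>t. p t + q t) \<in> trig"

lemma trig_mult: "p \<in> trig \<Longrightarrow> q \<in> trig \<Longrightarrow> (\<lambda>t. p t * q t) \<in> trig"
proof (induction arbitrary: q rule: trig.induct)
  case (fexp m)
  from fexp.prems show ?case
  proof (induction rule: trig.induct)
    case (fexp n)
    then show ?case using trig.fexp[of "m + n"] by (simp add: fexp_add[abs_def])
  next
    case (scale p c)
    then show ?case using trig.scale[of "\<lambda>t. fexp m t * p t" c] by (simp add: mult_ac)
  next
    case (add p q)
    then show ?case
      using trig.add[of "\<lambda>t. fexp m t * p t" "\<lambda>t. fexp m t * q t"] by (simp add: algebra_simps)
  qed
next
  case (scale p c)
  then show ?case using trig.scale[of "\<lambda>t. p t * q t" c] by (simp add: mult.assoc)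
next
  case (add p p')
  show ?case
    using trig.add[OF add.IH(1)[OF add.prems] add.IH(2)[OF add.prems]] by (simp add: distrib_right)
qed

lemma trig_continuous: "p \<in> trig \<Longrightarrow> continuous_on A p"
  by (induction rule: trig.induct) (auto intro!: continuous_intros)

lemma trig_const: "(\<lambda>t. c) \<in> trig"
  using trig.scale[OF trig.fexp[of 0], of c] by simp

text \<open>A real-linear functional of z is a complex combination of z and its conjugate, and on
  the circle the conjugate is again an exponential.\<close>

lemma trig_real_polynomial:
  "real_polynomial_function p \<Longrightarrow> (\<lambda>t. complex_of_real (p (fexp 1 t))) \<in> trig"
proof (induction rule: real_polynomial_function.induct)
  case (linear f)
  then have lin: "linear f" by (rule bounded_linear.linear)
  have eq: "complex_of_real (f z) = (f 1 - \<i> * f \<i>) / 2 * z + (f 1 + \<i> * f \<i>) / 2 * cnj z" for z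
  proof -
    have "z = Re z *\<^sub>R 1 + Im z *\<^sub>R \<i>" by (simp add: complex_eq_iff)
    then have "f z = Re z * f 1 + Im z * f \<i>"
      using linear_add[OF lin] linear_scale[OF lin] by (metis real_scaleR_def)
    then show ?thesis by (simp add: complex_eq_iff field_simps)
  qed
  have "(\<lambda>t. (f 1 - \<i> * f \<i>) / 2 * fexp 1 t + (f 1 + \<i> * f \<i>) / 2 * fexp (-1) t) \<in> trig"
    by (intro trig.intros)
  then show ?case by (subst eq) (simp add: cnj_fexp)
next
  case (const c)
  then show ?case using trig_const by auto
next
  case (add f g)
  then show ?case using trig.add by auto
next
  case (mult f g)
  then show ?case using trig_mult by auto
qed

lemma periodic_int:
  assumes "\<And>t. F (t + 1) = F (t::real)"
  shows "F (t + of_int k) = F t"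
proof -
  have *: "F (t + real n) = F t" for t n
  proof (induction n)
    case (Suc n)
    then show ?case using assms[of "t + real n"] by (simp add: algebra_simps)
  qed simp
  show ?thesis
  proof (cases "k \<ge> 0")
    case True
    then show ?thesis using *[of t "nat k"] by simp
  next
    case False
    then show ?thesis using *[of "t + of_int k" "nat (- k)"] by simp
  qed
qed

text \<open>A periodic function is a function on the unit circle, where Stone-Weierstrass supplies
  polynomials in the real coordinates; \<open>trig_real_polynomial\<close> turns these into
  trigonometric polynomials.\<close>

lemma trig_dense:
  assumes "continuous_on UNIV F" "\<And>t. F (t + 1) = F t" "e > 0"
  obtains p where "p \<in> trig" "\<And>t. cmod (F t - p t) < e"
proof -
  define G where "G z = F (Arg z / (2 * pi))" for z
  have Gfexp: "G (fexp 1 t) = F t" for t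
  proof -
    have "cis (Arg (fexp 1 t)) = cis (2 * pi * t)"
      using cis_Arg[of "fexp 1 t"] norm_fexp[of 1 t]
      by (metis fexp_def mult.right_neutral norm_zero of_int_1 scaleR_one sgn_div_norm inverse_1 zero_neq_one)
    then have "sin (Arg (fexp 1 t)) = sin (2 * pi * t) \<and> cos (Arg (fexp 1 t)) = cos (2 * pi * t)"
      by (simp add: complex_eq_iff)
    then obtain k :: int where "Arg (fexp 1 t) = 2 * pi * t + 2 * pi * k"
      unfolding sin_cos_eq_iff by (auto simp: mult_ac)
    then have "Arg (fexp 1 t) / (2 * pi) = t + of_int k" by (simp add: field_simps)
    then show ?thesis using periodic_int[of F, OF assms(2)] by (simp add: G_def)
  qed
  have Farg: "isCont F a" for a
    using assms(1) by (simp add: continuous_on_eq_continuous_at)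
  \<comment> \<open>\<open>Arg\<close> jumps on the negative real axis. \<open>Arg2pi\<close> yields
    the same function on the circle and jumps only on the positive axis, so every point has a
    continuous branch.\<close>
  have G2: "G z = F (Arg2pi z / (2 * pi))" if "cmod z = 1" for z
  proof -
    have "z = fexp 1 (Arg2pi z / (2 * pi))"
      using Arg2pi_eq[of z] that by (simp add: fexp_def cis_conv_exp)
    then show ?thesis using Gfexp[of "Arg2pi z / (2 * pi)"] by simp
  qed
  have cont: "continuous_on (sphere 0 1) G"
  proof (rule continuous_on_eq_continuous_within[THEN iffD2], rule ballI)
    fix z :: complex assume z: "z \<in> sphere 0 1"
    show "continuous (at z within sphere 0 1) G"
    proof (cases "z \<in> \<real>\<^sub>\<le>\<^sub>0")
      case False
      have "isCont (\<lambda>z. Arg z / (2 * pi)) z"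
        using continuous_at_Arg[OF False] by (intro continuous_intros) auto
      then have "isCont (F \<circ> (\<lambda>z. Arg z / (2 * pi))) z"
        by (rule continuous_at_compose) (rule Farg)
      then show ?thesis
        unfolding G_def[abs_def] o_def by (rule continuous_at_imp_continuous_at_within)
    next
      case True
      then have "z \<notin> \<real>\<^sub>\<ge>\<^sub>0"
        using z by (auto simp: complex_nonpos_Reals_iff complex_nonneg_Reals_iff complex_eq_iff norm_complex_def)
      then have "isCont (\<lambda>z. Arg2pi z / (2 * pi)) z"
        using continuous_at_Arg2pi by (intro continuous_intros) auto
      then have "isCont (F \<circ> (\<lambda>z. Arg2pi z / (2 * pi))) z"
        by (rule continuous_at_compose) (rule Farg)
      then have "continuous (at z within sphere 0 1) (\<lambda>z. F (Arg2pi z / (2 * pi)))"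
        unfolding o_def by (rule continuous_at_imp_continuous_at_within)
      then show ?thesis
        by (rule continuous_transform_within[OF _ zero_less_one z]) (auto simp: G2)
    qed
  qed
  obtain g where g: "polynomial_function g" "\<And>z. z \<in> sphere 0 1 \<Longrightarrow> cmod (G z - g z) < e"
    using Stone_Weierstrass_polynomial_function[OF compact_sphere cont assms(3)] by blast
  have re: "real_polynomial_function (\<lambda>z. Re (g z))" "real_polynomial_function (\<lambda>z. Im (g z))"
    using g(1) bounded_linear_Re bounded_linear_Im by (auto simp: polynomial_function_def o_def)
  have "(\<lambda>t. complex_of_real (Re (g (fexp 1 t))) + \<i> * complex_of_real (Im (g (fexp 1 t)))) \<in> trig"
    by (intro trig.intros trig_real_polynomial[OF re(1)] trig_real_polynomial[OF re(2)])
  also have "(\<lambda>t. complex_of_real (Re (g (fexp 1 t))) + \<i> * complex_of_real (Im (g (fexp 1 t)))) = (\<lambda>t. g (fexp 1 t))"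
    by (simp add: fun_eq_iff complex_eq_iff)
  finally have "(\<lambda>t. g (fexp 1 t)) \<in> trig" .
  moreover have "cmod (F t - g (fexp 1 t)) < e" for t
    using g(2)[of "fexp 1 t"] by (simp add: Gfexp)
  ultimately show ?thesis using that by blast
qed

text \<open>\<open>F\<close> is orthogonal to all trigonometric polynomials. These approximate the
  conjugate of \<open>F\<close> uniformly, so the integral of |F|^2 vanishes.\<close>

lemma fhat_eq_0_imp_zero:
  assumes F: "continuous_on UNIV F" "\<And>t. F (t + 1) = F t" and 0: "\<And>n. fhat F n = 0"
  shows "F t = 0"
proof -
  note cF = continuous_on_subset[OF F(1) subset_UNIV]
  have int: "(\<lambda>t. F t * p t) integrable_on {0..1}" if "continuous_on UNIV p" for p
    by (intro integrable_continuous_interval continuous_intros cF continuous_on_subset[OF that subset_UNIV])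
  have orth: "integral {0..1} (\<lambda>t. F t * p t) = 0" if "p \<in> trig" for p
    using that
  proof (induction rule: trig.induct)
    case (fexp n)
    then show ?case using 0[of "- n"] by (simp add: fhat_def)
  next
    case (scale p c)
    then show ?case
      using integral_mult_right[of "{0..1}" c "\<lambda>t. F t * p t"] by (simp add: mult_ac)
  next
    case (add p q)
    then show ?case
      using integral_add[OF int int, of p q] trig_continuous by (simp add: algebra_simps)
  qed
  have "bounded (F ` {0..1})"
    by (intro compact_imp_bounded compact_continuous_image cF) auto
  then obtain B where B: "B > 0" "\<And>t. t \<in> {0..1} \<Longrightarrow> cmod (F t) \<le> B"
    unfolding bounded_pos by auto
  define G where "G t = cnj (F t)" for t
  have cG: "continuous_on A G" for A
    unfolding G_def[abs_def] by (intro continuous_intros cF)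
  have per: "G (t + 1) = G t" for t by (simp add: G_def F)
  define I where "I = integral {0..1} (\<lambda>t. F t * G t)"
  have "cmod I \<le> B * e" if e: "e > 0" for e
  proof -
    obtain p where p: "p \<in> trig" "\<And>t. cmod (G t - p t) < e"
      using trig_dense[of G e] cG[of UNIV] per e by blast
    have "I = integral {0..1} (\<lambda>t. F t * G t) - integral {0..1} (\<lambda>t. F t * p t)"
      unfolding I_def using orth[OF p(1)] by simp
    also have "\<dots> = integral {0..1} (\<lambda>t. F t * (G t - p t))"
      using integral_diff[OF int[OF cG] int[OF trig_continuous[OF p(1)]]]
      by (simp add: right_diff_distrib)
    also have "cmod \<dots> \<le> B * e * (1 - 0)"
    proof (rule integral_bound)
      show "cmod (F t * (G t - p t)) \<le> B * e" if "t \<in> {0..1}" for t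
        unfolding norm_mult using B(1) B(2)[OF that] less_imp_le[OF p(2)[of t]]
        by (intro mult_mono) simp_all
    qed (simp_all add: continuous_on_mult[OF cF continuous_on_diff[OF cG trig_continuous[OF p(1)]]])
    finally show ?thesis by simp
  qed
  then have "cmod I \<le> 0 + e" if "e > 0" for e
    using divide_pos_pos[OF that B(1)] B(1) by fastforce
  then have "I = 0" using field_le_epsilon[of "cmod I" 0] by simp
  have "((\<lambda>t. F t * G t) has_integral 0) {0..1}"
    using integrable_integral[OF int[OF cG]] \<open>I = 0\<close> by (simp add: I_def)
  from has_integral_linear[OF this bounded_linear_Re]
  have "((\<lambda>t. Re (F t * G t)) has_integral 0) {0..1}"
    by (simp add: o_def)
  moreover have "(\<lambda>t. Re (F t * G t)) = (\<lambda>t. (cmod (F t))\<^sup>2)"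
    by (simp add: fun_eq_iff G_def cmod_power2 flip: power2_eq_square)
  ultimately have "((\<lambda>t. (cmod (F t))\<^sup>2) has_integral 0) (cbox 0 1)"
    by simp
  then have z: "(cmod (F t))\<^sup>2 = 0" if "t \<in> {0..1}" for t
    by (rule has_integral_0_cbox_imp_0[rotated 2]) (use that in \<open>auto intro!: continuous_intros cF\<close>)
  have "F t = F (frac t)"
    using periodic_int[of F "frac t" "\<lfloor>t\<rfloor>", OF F(2)] by (simp add: frac_def)
  then show ?thesis
    using z[of "frac t"] frac_ge_0[of t] frac_lt_1[of t] by (simp add: less_imp_le)
qed

subsection \<open>Fourier series\<close>

definition fseries :: "(int \<Rightarrow> complex) \<Rightarrow> real \<Rightarrow> complex" where
  "fseries a t = (\<Sum>\<^sub>\<infinity>n. a n * fexp n t)"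

context
  fixes a :: "int \<Rightarrow> complex"
  assumes a: "(\<lambda>n. cmod (a n)) summable_on UNIV"
begin

text \<open>The limit is along the net of finite frequency sets, the one that defines
  \<open>has_sum\<close>, so pointwise sums, continuity and termwise integration all follow from
  it.\<close>

lemma fseries_uniform_limit:
  "uniform_limit UNIV (\<lambda>A t. \<Sum>n\<in>A. a n * fexp n t) (fseries a) (finite_subsets_at_top UNIV)"
  unfolding fseries_def[abs_def]
  by (rule Weierstrass_m_test_general[OF _ a]) (simp add: norm_mult)

lemma fseries_has_sum: "((\<lambda>n. a n * fexp n t) has_sum fseries a t) UNIV"
  unfolding has_sum_def by (rule tendsto_uniform_limitI[OF fseries_uniform_limit]) simp

lemma continuous_on_fseries: "continuous_on A (fseries a)"
  by (rule continuous_on_subset[OF _ subset_UNIV], rule uniform_limit_theorem[OF _ fseries_uniform_limit])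
     (auto intro!: always_eventually continuous_intros)

lemma fseries_periodic: "fseries a (t + 1) = fseries a t"
  by (simp add: fseries_def fexp_periodic)

lemma fseries_pairing_has_sum:
  assumes \<phi>: "continuous_on {0..1} \<phi>"
  shows "((\<lambda>n. a n * integral {0..1} (\<lambda>t. fexp n t * \<phi> t)) has_sum
    integral {0..1} (\<lambda>t. fseries a t * \<phi> t)) UNIV"
proof -
  have "bounded (\<phi> ` {0..1})" "bounded (fseries a ` {0..1})"
    by (auto intro!: compact_imp_bounded compact_continuous_image \<phi> continuous_on_fseries)
  then have "uniform_limit {0..1} (\<lambda>A t. (\<Sum>n\<in>A. a n * fexp n t) * \<phi> t) (\<lambda>t. fseries a t * \<phi> t)
      (finite_subsets_at_top UNIV)"
    by (intro uniform_lim_mult uniform_limit_const uniform_limit_on_subset[OF fseries_uniform_limit]) auto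
  then obtain I J where IJ:
    "\<And>A. ((\<lambda>t. (\<Sum>n\<in>A. a n * fexp n t) * \<phi> t) has_integral I A) {0..1}"
    "((\<lambda>t. fseries a t * \<phi> t) has_integral J) {0..1}"
    "(I \<longlongrightarrow> J) (finite_subsets_at_top UNIV)"
    by (rule uniform_limit_integral) (auto intro!: continuous_intros \<phi>)
  have int: "(\<lambda>t. fexp n t * \<phi> t) integrable_on {0..1}" for n
    by (intro integrable_continuous_interval continuous_intros \<phi>)
  have "I A = (\<Sum>n\<in>A. a n * integral {0..1} (\<lambda>t. fexp n t * \<phi> t))" if "finite A" for A
  proof -
    have "((\<lambda>t. \<Sum>n\<in>A. a n * (fexp n t * \<phi> t)) has_integral
        (\<Sum>n\<in>A. a n * integral {0..1} (\<lambda>t. fexp n t * \<phi> t))) {0..1}"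
      by (intro has_integral_sum has_integral_mult_right that integrable_integral int)
    then show ?thesis
      using has_integral_unique[OF IJ(1)[of A]] by (simp add: sum_distrib_right mult.assoc)
  qed
  then have "((\<lambda>A. \<Sum>n\<in>A. a n * integral {0..1} (\<lambda>t. fexp n t * \<phi> t)) \<longlongrightarrow> J) (finite_subsets_at_top UNIV)"
    by (intro Lim_transform_eventually[OF IJ(3)] eventually_finite_subsets_at_top_weakI) auto
  then show ?thesis
    using IJ(2) by (simp add: has_sum_def integral_unique)
qed

lemma fhat_fseries: "fhat (fseries a) m = a m"
proof -
  have "(\<lambda>t. fexp n t * fexp (- m) t) = fexp (n - m)" for n
    by (simp add: fun_eq_iff flip: fexp_add)
  then have "((\<lambda>n. a n * (if n = m then 1 else 0)) has_sum fhat (fseries a) m) UNIV"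
    using fseries_pairing_has_sum[of "fexp (- m)"] integral_fexp
    by (simp add: continuous_on_fexp fhat_def)
  moreover have "((\<lambda>n. a n * (if n = m then 1 else 0)) has_sum a m) UNIV"
    using has_sum_finite[of "{m}" "\<lambda>n. a n * (if n = m then 1 else 0)"]
    by (subst has_sum_cong_neutral[where T="{m}"]) auto
  ultimately show ?thesis by (rule has_sum_unique)
qed

end

lemma fhat_inject:
  assumes "continuous_on UNIV F" "\<And>t. F (t + 1) = F t"
    and "continuous_on UNIV G" "\<And>t. G (t + 1) = G t"
    and "\<And>n. fhat F n = fhat G n"
  shows "F = G"
proof
  fix t
  have "fhat (\<lambda>t. F t - G t) n = 0" for n
  proof -
    have "(\<lambda>t. F t * fexp (- n) t) integrable_on {0..1}" "(\<lambda>t. G t * fexp (- n) t) integrable_on {0..1}"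
      by (auto intro!: integrable_continuous_interval continuous_intros
          intro: continuous_on_subset[OF assms(1)] continuous_on_subset[OF assms(3)])
    from integral_diff[OF this] show ?thesis
      using assms(5)[of n] by (simp add: fhat_def left_diff_distrib)
  qed
  then show "F t = G t"
    using fhat_eq_0_imp_zero[of "\<lambda>t. F t - G t"] assms by (auto intro: continuous_intros)
qed

text \<open>Both sides are continuous and periodic with the same coefficients, so pointwise
  convergence comes from uniqueness rather than from a kernel estimate.\<close>

lemma test_function_eq_fseries:
  assumes "\<phi> \<in> test_functions"
  shows "fseries (fhat \<phi>) = \<phi>"
proof (rule fhat_inject)
  show "continuous_on UNIV (fseries (fhat \<phi>))" "fseries (fhat \<phi>) (t + 1) = fseries (fhat \<phi>) t"
    "fhat (fseries (fhat \<phi>)) n = fhat \<phi> n" for t n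
    using assms by (auto intro: continuous_on_fseries fseries_periodic fhat_fseries summable_fhat)
qed (auto intro: continuous_on_test_function test_function_periodic assms)

section \<open>Distributions are determined by their Fourier coefficients\<close>

lemma dist_apply_add:
  "\<phi> \<in> test_functions \<Longrightarrow> \<psi> \<in> test_functions \<Longrightarrow>
    dist_apply f (\<lambda>t. \<phi> t + \<psi> t) = dist_apply f \<phi> + dist_apply f \<psi>"
  and dist_apply_scale: "\<phi> \<in> test_functions \<Longrightarrow> dist_apply f (\<lambda>t. c * \<phi> t) = c * dist_apply f \<phi>"
  and dist_apply_bounded: "\<exists>k C. \<forall>\<phi>\<in>test_functions. cmod (dist_apply f \<phi>) \<le> C * test_seminorm k \<phi>"
  and dist_apply_outside: "\<phi> \<notin> test_functions \<Longrightarrow> dist_apply f \<phi> = 0"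
  using dist_apply[of f] by auto

lemma dist_apply_sum_fexp:
  "finite A \<Longrightarrow> dist_apply f (\<lambda>t. \<Sum>n\<in>A. c n * fexp n t) = (\<Sum>n\<in>A. c n * dist_apply f (fexp n))"
proof (induction A rule: finite_induct)
  case empty
  then show ?case using dist_apply_scale[of "fexp 0" f 0] by simp
next
  case (insert m A)
  then show ?case
    using dist_apply_add[of "\<lambda>t. c m * fexp m t" "\<lambda>t. \<Sum>n\<in>A. c n * fexp n t" f]
      test_functions_sum_fexp[OF insert(1), of c] fexp_test_function[of "c m" m]
    by (simp add: dist_apply_scale)
qed

text \<open>A distribution is continuous for some seminorm, and the Fourier partial sums of
  \<open>\<phi>\<close> converge to \<open>\<phi>\<close> in each of them.\<close>

lemma dist_apply_has_sum:
  assumes \<phi>: "\<phi> \<in> test_functions"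
  shows "((\<lambda>n. fhat \<phi> n * dist_apply f (fexp n)) has_sum dist_apply f \<phi>) UNIV"
proof -
  let ?F = "finite_subsets_at_top (UNIV :: int set)"
  define p where "p A t = (\<Sum>n\<in>A. fhat \<phi> n * fexp n t)" for A t
  have p: "p A \<in> test_functions" if "finite A" for A
    unfolding p_def[abs_def] using test_functions_sum_fexp[OF that] by blast
  \<comment> \<open>Derivatives of partial sums are partial sums of derivatives, so
    \<open>fseries_uniform_limit\<close> governs each order separately.\<close>
  have d: "(vderiv ^^ j) (\<lambda>t. \<phi> t - p A t) =
      (\<lambda>t. (vderiv ^^ j) \<phi> t - (\<Sum>n\<in>A. fhat ((vderiv ^^ j) \<phi>) n * fexp n t))" if "finite A" for A j
    using vderiv_pow_add[OF \<phi> p[OF that], of j "-1"]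
      conjunct2[OF test_functions_sum_fexp[OF that, of "fhat \<phi>" j]]
    by (simp add: p_def[abs_def] fhat_vderiv_pow[OF \<phi>])
  obtain k C where C: "\<And>\<psi>. \<psi> \<in> test_functions \<Longrightarrow> cmod (dist_apply f \<psi>) \<le> C * test_seminorm k \<psi>"
    using dist_apply_bounded by blast
  have small: "\<forall>\<^sub>F A in ?F. test_seminorm k (\<lambda>t. \<phi> t - p A t) \<le> e" if "e > 0" for e
  proof -
    \<comment> \<open>The seminorm of order \<open>k\<close> has \<open>Suc k\<close>
      summands.\<close>
    define e' where "e' = e / real (Suc k)"
    have "e' > 0" using that by (simp add: e'_def)
    have ev: "\<forall>\<^sub>F A in ?F. \<forall>t. cmod ((vderiv ^^ j) \<phi> t - (\<Sum>n\<in>A. fhat ((vderiv ^^ j) \<phi>) n * fexp n t)) < e'" for j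
      using fseries_uniform_limit[OF summable_fhat[OF vderiv_pow_test_function[OF \<phi>, of j]]] \<open>e' > 0\<close>
      unfolding uniform_limit_iff test_function_eq_fseries[OF vderiv_pow_test_function[OF \<phi>, of j]]
      by (simp add: dist_norm norm_minus_commute)
    have "\<forall>\<^sub>F A in ?F. \<forall>j\<in>{..k}. \<forall>t. cmod ((vderiv ^^ j) \<phi> t - (\<Sum>n\<in>A. fhat ((vderiv ^^ j) \<phi>) n * fexp n t)) < e'"
      by (intro eventually_ball_finite ballI ev) auto
    moreover have "\<forall>\<^sub>F A in ?F. finite A"
      by (rule eventually_finite_subsets_at_top_weakI) auto
    ultimately show ?thesis
    proof eventually_elim
      case (elim A)
      have "test_seminorm k (\<lambda>t. \<phi> t - p A t) \<le> (\<Sum>j\<le>k. e')"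
        unfolding test_seminorm_def d[OF \<open>finite A\<close>]
        by (intro sum_mono cSUP_least) (use elim in \<open>auto intro: less_imp_le\<close>)
      also have "\<dots> = e" by (simp add: e'_def)
      finally show ?case .
    qed
  qed
  have "((\<lambda>A. dist_apply f (p A)) \<longlongrightarrow> dist_apply f \<phi>) ?F"
  proof (rule tendstoI)
    fix e :: real assume "e > 0"
    \<comment> \<open>\<open>C\<close> may be zero or negative, hence
      \<open>\<bar>C\<bar> + 1\<close>; the 2 makes the final inequality strict.\<close>
    then have "e / (2 * (\<bar>C\<bar> + 1)) > 0" by simp
    from small[OF this] have "\<forall>\<^sub>F A in ?F. test_seminorm k (\<lambda>t. \<phi> t - p A t) \<le> e / (2 * (\<bar>C\<bar> + 1))" .
    moreover have "\<forall>\<^sub>F A in ?F. finite A"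
      by (rule eventually_finite_subsets_at_top_weakI) auto
    ultimately show "\<forall>\<^sub>F A in ?F. dist (dist_apply f (p A)) (dist_apply f \<phi>) < e"
    proof eventually_elim
      case (elim A)
      have t: "(\<lambda>t. \<phi> t - p A t) \<in> test_functions"
        using test_functions_add[OF \<phi> p[OF elim(2)], of "-1"] by simp
      have "dist_apply f \<phi> = dist_apply f (\<lambda>t. \<phi> t - p A t) + dist_apply f (p A)"
        using dist_apply_add[OF t p[OF elim(2)], of f] by simp
      then have "dist (dist_apply f (p A)) (dist_apply f \<phi>) = cmod (dist_apply f (\<lambda>t. \<phi> t - p A t))"
        by (simp add: dist_norm norm_minus_commute)
      also have "\<dots> \<le> C * test_seminorm k (\<lambda>t. \<phi> t - p A t)" by (rule C[OF t])
      also have "\<dots> \<le> (\<bar>C\<bar> + 1) * (e / (2 * (\<bar>C\<bar> + 1)))"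
        using elim(1) test_seminorm_mono(1)[OF t, of k k] by (intro mult_mono) auto
      also have "\<dots> = e / 2" by (simp add: field_simps)
      finally show ?case using \<open>e > 0\<close> by simp
    qed
  qed
  then show ?thesis
    unfolding has_sum_def
    by (rule Lim_transform_eventually)
       (auto intro!: eventually_finite_subsets_at_top_weakI simp: p_def[abs_def] dist_apply_sum_fexp)
qed

lemma fourier_coeff_eq: "fourier_coeff f n = dist_apply f (fexp (- n))"
  by (simp add: fourier_coeff_def fexp_def[abs_def])

lemma fourier_coeff_inject:
  assumes "\<And>n. fourier_coeff f n = fourier_coeff g n"
  shows "f = g"
proof -
  have eq: "dist_apply f (fexp n) = dist_apply g (fexp n)" for n
    using assms[of "- n"] by (simp add: fourier_coeff_eq)
  have "dist_apply f \<phi> = dist_apply g \<phi>" for \<phi>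
  proof (cases "\<phi> \<in> test_functions")
    case True
    from dist_apply_has_sum[OF True, of f] dist_apply_has_sum[OF True, of g]
    show ?thesis unfolding eq by (rule has_sum_unique)
  qed (simp add: dist_apply_outside)
  then show ?thesis by (simp add: fun_eq_iff flip: dist_apply_inject)
qed

lemma fourier_coeff_linear [simp]:
  "fourier_coeff (f + g) n = fourier_coeff f n + fourier_coeff g n"
  "fourier_coeff (f - g) n = fourier_coeff f n - fourier_coeff g n"
  "fourier_coeff (pscale c f) n = c * fourier_coeff f n"
  "fourier_coeff 0 n = 0"
  by (simp_all add: fourier_coeff_def plus_pdist.rep_eq minus_pdist.rep_eq pscale.rep_eq zero_pdist.rep_eq)

subsection \<open>Point values\<close>

lemma represents_unique:
  assumes "represents F f" "represents G f"
  shows "F = G"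
proof (rule fhat_inject)
  show "fhat F n = fhat G n" for n
    using assms by (auto simp: represents_def fhat_def)
qed (use assms in \<open>auto simp: represents_def\<close>)

lemma point_value_eqI: "represents F f \<Longrightarrow> point_value f = F"
  unfolding point_value_def using represents_unique by blast

lemma represents_fseries:
  assumes "(\<lambda>n. cmod (fourier_coeff f n)) summable_on UNIV"
  shows "represents (fseries (fourier_coeff f)) f"
  unfolding represents_def
proof (intro conjI ballI allI)
  fix \<phi> assume \<phi>: "\<phi> \<in> test_functions"
  have "((\<lambda>n. fourier_coeff f n * integral {0..1} (\<lambda>t. fexp n t * \<phi> t)) has_sum
      integral {0..1} (\<lambda>t. fseries (fourier_coeff f) t * \<phi> t)) UNIV"
    by (rule fseries_pairing_has_sum[OF assms continuous_on_test_function[OF \<phi>]])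
  \<comment> \<open>\<open>fourier_coeff f n\<close> tests against \<open>fexp (- n)\<close>,
    whereas \<open>dist_apply_has_sum\<close> sums over \<open>fexp n\<close>; reflecting the index
    matches the two expansions.\<close>
  then have "((\<lambda>n. fourier_coeff f (- n) * integral {0..1} (\<lambda>t. fexp (- n) t * \<phi> t)) has_sum
      integral {0..1} (\<lambda>t. fseries (fourier_coeff f) t * \<phi> t)) UNIV"
    by (subst has_sum_reindex_bij_betw[of uminus UNIV UNIV]) (auto intro: bij_uminus)
  then have "((\<lambda>n. fhat \<phi> n * dist_apply f (fexp n)) has_sum
      integral {0..1} (\<lambda>t. fseries (fourier_coeff f) t * \<phi> t)) UNIV"
    by (simp add: fourier_coeff_eq fhat_def mult.commute)
  with dist_apply_has_sum[OF \<phi>, of f]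
  show "dist_apply f \<phi> = integral {0..1} (\<lambda>t. fseries (fourier_coeff f) t * \<phi> t)"
    by (rule has_sum_unique)
qed (auto intro: continuous_on_fseries fseries_periodic assms)

lemma point_value_eq_fseries:
  "(\<lambda>n. cmod (fourier_coeff f n)) summable_on UNIV \<Longrightarrow> point_value f = fseries (fourier_coeff f)"
  by (intro point_value_eqI represents_fseries)

subsection \<open>Sobolev norms\<close>

text \<open>The weighted coefficients turn H^s into plain l^2 over the integers, and
  \<open>L2_set\<close> supplies the triangle inequality on finite frequency sets.\<close>

definition wcoeff :: "real \<Rightarrow> pdist \<Rightarrow> int \<Rightarrow> real" where
  "wcoeff s f n = bracket n powr s * cmod (fourier_coeff f n)"

lemma wcoeff_nonneg [simp]: "wcoeff s f n \<ge> 0"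
  by (simp add: wcoeff_def)

lemma wcoeff_square:
  "(wcoeff s f n)\<^sup>2 = (if n = 0 then (cmod (fourier_coeff f 0))\<^sup>2
    else \<bar>of_int n\<bar> powr (2 * s) * (cmod (fourier_coeff f n))\<^sup>2)"
proof -
  have "bracket n = (if n = 0 then 1 else \<bar>of_int n\<bar>)"
    by (auto simp: bracket_def max_def)
  then show ?thesis
    by (auto simp: wcoeff_def power_mult_distrib powr_power mult.commute)
qed

lemma sobolev_space_iff: "f \<in> sobolev_space s \<longleftrightarrow> (\<lambda>n. (wcoeff s f n)\<^sup>2) summable_on UNIV"
proof -
  have "f \<in> sobolev_space s \<longleftrightarrow> (\<lambda>n. (wcoeff s f n)\<^sup>2) summable_on - {0}"
    unfolding sobolev_space_def mem_Collect_eq by (intro summable_on_cong) (simp add: wcoeff_square)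
  also have "\<dots> \<longleftrightarrow> (\<lambda>n. (wcoeff s f n)\<^sup>2) summable_on UNIV"
  proof
    assume "(\<lambda>n. (wcoeff s f n)\<^sup>2) summable_on - {0}"
    then have "(\<lambda>n. (wcoeff s f n)\<^sup>2) summable_on - {0} \<union> {0}"
      by (intro summable_on_Un_disjoint) auto
    moreover have "- {0} \<union> {0} = (UNIV :: int set)" by auto
    ultimately show "(\<lambda>n. (wcoeff s f n)\<^sup>2) summable_on UNIV" by simp
  qed (auto intro: summable_on_subset_banach)
  finally show ?thesis .
qed

lemma sobolev_norm_eq:
  assumes "f \<in> sobolev_space s"
  shows "sobolev_norm s f = sqrt (\<Sum>\<^sub>\<infinity>n. (wcoeff s f n)\<^sup>2)"
proof -
  have sum: "(\<lambda>n. (wcoeff s f n)\<^sup>2) summable_on - {0}"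
    using assms unfolding sobolev_space_iff by (rule summable_on_subset_banach) auto
  have "(\<Sum>\<^sub>\<infinity>n. (wcoeff s f n)\<^sup>2) = (\<Sum>\<^sub>\<infinity>n\<in>{0} \<union> - {0}. (wcoeff s f n)\<^sup>2)"
    by simp
  also have "\<dots> = (\<Sum>\<^sub>\<infinity>n\<in>{0}. (wcoeff s f n)\<^sup>2) + (\<Sum>\<^sub>\<infinity>n\<in>- {0}. (wcoeff s f n)\<^sup>2)"
    by (rule infsum_Un_disjoint) (auto intro: sum)
  also have "(\<Sum>\<^sub>\<infinity>n\<in>- {0}. (wcoeff s f n)\<^sup>2) =
      (\<Sum>\<^sub>\<infinity>n\<in>- {0}. \<bar>of_int n\<bar> powr (2 * s) * (cmod (fourier_coeff f n))\<^sup>2)"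
    by (rule infsum_cong) (simp add: wcoeff_square)
  finally show ?thesis
    by (simp add: sobolev_norm_def wcoeff_square)
qed

lemma sobolev_norm_nonneg [simp]: "sobolev_norm s f \<ge> 0"
  unfolding sobolev_norm_def by (intro real_sqrt_ge_zero add_nonneg_nonneg infsum_nonneg) auto

lemma sobolev_norm_has_sum:
  "f \<in> sobolev_space s \<Longrightarrow> ((\<lambda>n. (wcoeff s f n)\<^sup>2) has_sum (sobolev_norm s f)\<^sup>2) UNIV"
  by (simp add: sobolev_norm_eq infsum_nonneg sobolev_space_iff)

lemma L2_set_wcoeff_le:
  assumes "f \<in> sobolev_space s" "finite A"
  shows "L2_set (wcoeff s f) A \<le> sobolev_norm s f"
  unfolding L2_set_def
  by (rule real_le_lsqrt)
     (auto intro!: finite_sum_le_has_sum[OF sobolev_norm_has_sum] assms sum_nonneg)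

text \<open>A bound uniform over finite frequency sets gives membership and norm bound together, so
  norm inequalities in H^s reduce to \<open>L2_set\<close> inequalities.\<close>

lemma sobolev_boundedI:
  assumes "\<And>A. finite A \<Longrightarrow> L2_set (wcoeff s f) A \<le> B"
  shows "f \<in> sobolev_space s" "sobolev_norm s f \<le> B"
proof -
  have B: "B \<ge> 0" using assms[of "{}"] by simp
  have le: "(\<Sum>n\<in>A. (wcoeff s f n)\<^sup>2) \<le> B\<^sup>2" if "finite A" for A
    using assms[OF that] by (metis L2_set_def sqrt_le_D)
  show *: "f \<in> sobolev_space s"
    unfolding sobolev_space_iff
    by (rule nonneg_bdd_above_summable_on) (auto intro!: bdd_aboveI2[where M="B\<^sup>2"] le)
  then have "(\<Sum>\<^sub>\<infinity>n. (wcoeff s f n)\<^sup>2) \<le> B\<^sup>2"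
    by (intro infsum_le_finite_sums le) (auto simp: sobolev_space_iff)
  then show "sobolev_norm s f \<le> B"
    using B by (simp add: sobolev_norm_eq[OF *] real_le_lsqrt)
qed

lemma sobolev_add:
  assumes "f \<in> sobolev_space s" "g \<in> sobolev_space s"
  shows "f + g \<in> sobolev_space s" "sobolev_norm s (f + g) \<le> sobolev_norm s f + sobolev_norm s g"
proof -
  have "L2_set (wcoeff s (f + g)) A \<le> sobolev_norm s f + sobolev_norm s g" if "finite A" for A
  proof -
    have "L2_set (wcoeff s (f + g)) A \<le> L2_set (\<lambda>n. wcoeff s f n + wcoeff s g n) A"
      by (rule L2_set_mono)
         (auto simp: wcoeff_def distrib_left[symmetric] intro!: mult_left_mono norm_triangle_ineq)
    also have "\<dots> \<le> L2_set (wcoeff s f) A + L2_set (wcoeff s g) A"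
      by (rule L2_set_triangle_ineq)
    also have "\<dots> \<le> sobolev_norm s f + sobolev_norm s g"
      by (intro add_mono L2_set_wcoeff_le assms that)
    finally show ?thesis .
  qed
  then show "f + g \<in> sobolev_space s" "sobolev_norm s (f + g) \<le> sobolev_norm s f + sobolev_norm s g"
    by (auto intro: sobolev_boundedI)
qed

lemma sobolev_pscale:
  assumes "f \<in> sobolev_space s"
  shows "pscale c f \<in> sobolev_space s" "sobolev_norm s (pscale c f) = cmod c * sobolev_norm s f"
proof -
  have w: "(wcoeff s (pscale c f) n)\<^sup>2 = (cmod c)\<^sup>2 * (wcoeff s f n)\<^sup>2" for n
    by (simp add: wcoeff_def norm_mult power_mult_distrib)
  show *: "pscale c f \<in> sobolev_space s"
    using assms unfolding sobolev_space_iff w by (rule summable_on_cmult_right)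
  show "sobolev_norm s (pscale c f) = cmod c * sobolev_norm s f"
    unfolding sobolev_norm_eq[OF assms] sobolev_norm_eq[OF *] w
    by (simp add: infsum_cmult_right' real_sqrt_mult)
qed

lemma sobolev_uminus:
  assumes "f \<in> sobolev_space s"
  shows "- f \<in> sobolev_space s" "sobolev_norm s (- f) = sobolev_norm s f"
proof -
  have "- f = pscale (-1) f"
    by (rule fourier_coeff_inject) (use fourier_coeff_linear(2)[of 0 f] in simp)
  then show "- f \<in> sobolev_space s" "sobolev_norm s (- f) = sobolev_norm s f"
    using sobolev_pscale[OF assms, of "-1"] by auto
qed

lemma sobolev_diff:
  assumes "f \<in> sobolev_space s" "g \<in> sobolev_space s"
  shows "f - g \<in> sobolev_space s" "sobolev_norm s (f - g) \<le> sobolev_norm s f + sobolev_norm s g"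
  using sobolev_add[OF assms(1) sobolev_uminus(1)[OF assms(2)]] sobolev_uminus(2)[OF assms(2)] by auto

lemma sobolev_mono:
  assumes "f \<in> sobolev_space t" "s \<le> t"
  shows "f \<in> sobolev_space s" "sobolev_norm s f \<le> sobolev_norm t f"
proof -
  have "L2_set (wcoeff s f) A \<le> sobolev_norm t f" if "finite A" for A
  proof -
    have "L2_set (wcoeff s f) A \<le> L2_set (wcoeff t f) A"
      using assms(2) by (intro L2_set_mono) (auto simp: wcoeff_def intro!: mult_right_mono powr_mono)
    also have "\<dots> \<le> sobolev_norm t f" by (rule L2_set_wcoeff_le[OF assms(1) that])
    finally show ?thesis .
  qed
  then show "f \<in> sobolev_space s" "sobolev_norm s f \<le> sobolev_norm t f"
    by (auto intro: sobolev_boundedI)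
qed

lemma sobolev_norm_eq_0:
  assumes "f \<in> sobolev_space s" "sobolev_norm s f = 0"
  shows "f = 0"
proof (rule fourier_coeff_inject)
  fix n
  have "wcoeff s f n = 0"
    using L2_set_wcoeff_le[OF assms(1), of "{n}"] assms(2) wcoeff_nonneg[of s f n] by simp
  then show "fourier_coeff f n = fourier_coeff 0 n"
    using bracket_pos[of n] by (simp add: wcoeff_def)
qed

lemma l2_pairing_self:
  assumes "f \<in> sobolev_space 0"
  shows "l2_pairing f f = of_real ((sobolev_norm 0 f)\<^sup>2)"
proof -
  have "((\<lambda>n. complex_of_real ((wcoeff 0 f n)\<^sup>2)) has_sum of_real ((sobolev_norm 0 f)\<^sup>2)) UNIV"
    by (intro has_sum_of_real sobolev_norm_has_sum assms)
  also have "(\<lambda>n. complex_of_real ((wcoeff 0 f n)\<^sup>2)) = (\<lambda>n. cnj (fourier_coeff f n) * fourier_coeff f n)"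
    using bracket_pos by (simp add: fun_eq_iff wcoeff_def less_imp_neq[THEN not_sym] complex_norm_square mult.commute flip: of_real_power)
  finally show ?thesis
    unfolding l2_pairing_def by (rule infsumI)
qed

text \<open>Sobolev embedding: ab \<le> a^2 + b^2 with a =
  \<open>bracket n powr (- \<sigma>)\<close> and b = \<open>wcoeff \<sigma> f n\<close>, where
  2\<sigma> > 1 makes the squares of a summable.\<close>

lemma summable_fourier_coeff:
  assumes "f \<in> sobolev_space \<sigma>" "\<sigma> > 1/2"
  shows "(\<lambda>n. cmod (fourier_coeff f n)) summable_on UNIV"
proof -
  have "(\<lambda>n. bracket n powr (- (2 * \<sigma>)) + (wcoeff \<sigma> f n)\<^sup>2) summable_on UNIV"
    using assms by (intro summable_on_add summable_bracket) (auto simp: sobolev_space_iff)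
  moreover have "norm (fourier_coeff f n) \<le> bracket n powr (- (2 * \<sigma>)) + (wcoeff \<sigma> f n)\<^sup>2" for n
  proof -
    have "cmod (fourier_coeff f n) = bracket n powr (- \<sigma>) * wcoeff \<sigma> f n"
      using bracket_pos[of n] by (simp add: wcoeff_def less_imp_neq[THEN not_sym] flip: mult.assoc powr_add)
    also have "\<dots> \<le> (bracket n powr (- \<sigma>))\<^sup>2 + (wcoeff \<sigma> f n)\<^sup>2"
    proof -
      have "0 \<le> bracket n powr (- \<sigma>) * wcoeff \<sigma> f n" by simp
      then show ?thesis
        using sum_squares_bound[of "bracket n powr (- \<sigma>)" "wcoeff \<sigma> f n"] by linarith
    qed
    also have "(bracket n powr (- \<sigma>))\<^sup>2 = bracket n powr (- (2 * \<sigma>))"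
      by (simp add: power2_eq_square flip: powr_add)
    finally show ?thesis by simp
  qed
  ultimately show ?thesis
    using Infinite_Sum.abs_summable_on_comparison_test'[of "\<lambda>n. bracket n powr (- (2 * \<sigma>)) + (wcoeff \<sigma> f n)\<^sup>2" UNIV "fourier_coeff f"]
    by blast
qed

subsection \<open>Trigonometric polynomials as distributions\<close>

lift_definition fexp_dist :: "int \<Rightarrow> pdist" is
  "\<lambda>m \<phi>. if \<phi> \<in> test_functions then integral {0..1} (\<lambda>t. fexp m t * \<phi> t) else 0"
proof (intro conjI ballI allI impI)
  fix m :: int and \<phi> \<psi> :: "real \<Rightarrow> complex" and c
  let ?T = "\<lambda>\<phi>. if \<phi> \<in> test_functions then integral {0..1} (\<lambda>t. fexp m t * \<phi> t) else 0"
  have int: "(\<lambda>t. fexp m t * \<phi> t) integrable_on {0..1}" if "\<phi> \<in> test_functions" for \<phi>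
    by (intro integrable_continuous_interval continuous_intros continuous_on_test_function that)
  show "?T \<phi> = 0" if "\<phi> \<notin> test_functions" using that by simp
  show "?T (\<lambda>t. \<phi> t + \<psi> t) = ?T \<phi> + ?T \<psi>" if "\<phi> \<in> test_functions" "\<psi> \<in> test_functions"
    using test_functions_add[OF that, of 1] integral_add[OF int[OF that(1)] int[OF that(2)]] that
    by (simp add: distrib_left)
  show "?T (\<lambda>t. c * \<phi> t) = c * ?T \<phi>"
  proof -
    have zero: "(\<lambda>t. 0) \<in> test_functions" using fexp_test_function[of 0 0] by simp
    have sc: "(\<lambda>t. c * \<phi> t) \<in> test_functions" if "\<phi> \<in> test_functions" for c \<phi>
      using test_functions_add[OF zero that, of c] by simp
    \<comment> \<open>The identity is proved for every \<open>\<phi>\<close>; for one outside the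
      test functions, \<open>c * \<phi>\<close> has to stay outside as well unless
      \<open>c = 0\<close>.\<close>
    have "\<phi> \<in> test_functions" if "c \<noteq> 0" "(\<lambda>t. c * \<phi> t) \<in> test_functions"
      using sc[OF that(2), of "1 / c"] that(1) by simp
    then show ?thesis
      using sc[of \<phi> c] integral_mult_right[of "{0..1}" c "\<lambda>t. fexp m t * \<phi> t"]
      by (auto simp: mult.left_commute)
  qed
  show "\<exists>k C. \<forall>\<phi>\<in>test_functions. cmod (?T \<phi>) \<le> C * test_seminorm k \<phi>"
  proof (intro exI ballI)
    fix \<phi> assume \<phi>: "\<phi> \<in> test_functions"
    have "bounded (\<phi> ` {0..1})"
      by (intro compact_imp_bounded compact_continuous_image continuous_on_test_function \<phi>) auto
    then have "bdd_above ((\<lambda>t. cmod (\<phi> t)) ` {0..1})"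
      by (auto simp: bounded_iff bdd_above_def)
    then have "cmod (fexp m t * \<phi> t) \<le> test_seminorm 0 \<phi>" if "t \<in> {0..1}" for t
      using that by (auto simp: norm_mult test_seminorm_def intro!: cSUP_upper)
    then have "cmod (integral {0..1} (\<lambda>t. fexp m t * \<phi> t)) \<le> test_seminorm 0 \<phi> * (1 - 0)"
      by (intro integral_bound continuous_intros continuous_on_test_function \<phi>) simp_all
    then show "cmod (?T \<phi>) \<le> 1 * test_seminorm 0 \<phi>" using \<phi> by simp
  qed
qed

lemma fourier_coeff_fexp_dist: "fourier_coeff (fexp_dist m) n = (if n = m then 1 else 0)"
proof -
  have "(\<lambda>t. fexp m t * fexp (- n) t) = fexp (m - n)"
    by (simp add: fun_eq_iff flip: fexp_add)
  then show ?thesis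
    by (simp add: fourier_coeff_eq fexp_dist.rep_eq integral_fexp)
qed

text \<open>The distributions to which the quadrature estimate applies freely: they lie in every
  H^s, and their point values are finite sums.\<close>

definition trig_dist :: "(int \<Rightarrow> complex) \<Rightarrow> int set \<Rightarrow> pdist" where
  "trig_dist a A = (\<Sum>n\<in>A. pscale (a n) (fexp_dist n))"

lemma fourier_coeff_trig_dist:
  "finite A \<Longrightarrow> fourier_coeff (trig_dist a A) n = (if n \<in> A then a n else 0)"
proof (induction A rule: finite_induct)
  case empty
  then show ?case by (simp add: trig_dist_def)
next
  case (insert m A)
  then show ?case
    by (auto simp: trig_dist_def fourier_coeff_fexp_dist)
qed

lemma trig_dist_sobolev:
  assumes "finite A"
  shows "trig_dist a A \<in> sobolev_space s"
    "sobolev_norm s (trig_dist a A) = L2_set (\<lambda>n. bracket n powr s * cmod (a n)) A"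
proof -
  have "((\<lambda>n. (wcoeff s (trig_dist a A) n)\<^sup>2) has_sum (\<Sum>n\<in>A. (bracket n powr s * cmod (a n))\<^sup>2)) UNIV"
    using has_sum_finite[OF assms, of "\<lambda>n. (bracket n powr s * cmod (a n))\<^sup>2"]
    by (subst has_sum_cong_neutral[where T=A and g="\<lambda>n. (bracket n powr s * cmod (a n))\<^sup>2"])
       (auto simp: wcoeff_def fourier_coeff_trig_dist assms)
  then show "trig_dist a A \<in> sobolev_space s"
    "sobolev_norm s (trig_dist a A) = L2_set (\<lambda>n. bracket n powr s * cmod (a n)) A"
    by (auto simp: sobolev_space_iff has_sum_imp_summable infsumI L2_set_def
        sobolev_norm_eq[of "trig_dist a A"])
qed

lemma point_value_trig_dist:
  assumes "finite A"
  shows "point_value (trig_dist a A) t = (\<Sum>n\<in>A. a n * fexp n t)"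
proof -
  have "point_value (trig_dist a A) t = fseries (fourier_coeff (trig_dist a A)) t"
    by (subst point_value_eq_fseries)
       (auto intro!: summable_fourier_coeff[of _ 1] trig_dist_sobolev assms)
  also have "\<dots> = (\<Sum>n\<in>A. a n * fexp n t)"
    unfolding fseries_def infsum_finite[OF assms, symmetric]
    by (rule infsum_cong_neutral) (auto simp: fourier_coeff_trig_dist assms)
  finally show ?thesis .
qed

text \<open>\<open>point_value\<close> is a definite description, so linearity has to come from
  representatives. For \<sigma> > 1/2 these are the sums of the Fourier series.\<close>

lemma point_value_linear:
  assumes "f \<in> sobolev_space \<sigma>" "g \<in> sobolev_space \<sigma>" "\<sigma> > 1/2"
  shows "point_value (f + g) t = point_value f t + point_value g t"
    "point_value (f - g) t = point_value f t - point_value g t"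
    "point_value (pscale c f) t = c * point_value f t"
proof -
  have pv: "((\<lambda>n. fourier_coeff u n * fexp n t) has_sum point_value u t) UNIV" if "u \<in> sobolev_space \<sigma>" for u
    using summable_fourier_coeff[OF that assms(3)]
    by (simp add: point_value_eq_fseries fseries_has_sum)
  note pvs = pv[OF assms(1)] pv[OF assms(2)]
  show "point_value (f + g) t = point_value f t + point_value g t"
    by (rule has_sum_unique[OF pv[OF sobolev_add(1)[OF assms(1,2)]]])
       (use has_sum_add[OF pvs] in \<open>simp add: distrib_right\<close>)
  show "point_value (f - g) t = point_value f t - point_value g t"
    by (rule has_sum_unique[OF pv[OF sobolev_diff(1)[OF assms(1,2)]]])
       (use has_sum_add[OF pvs(1) has_sum_cmult_right[OF pvs(2), of "-1"]] in \<open>simp add: left_diff_distrib\<close>)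
  show "point_value (pscale c f) t = c * point_value f t"
    by (rule has_sum_unique[OF pv[OF sobolev_pscale(1)[OF assms(1)]]])
       (use has_sum_cmult_right[OF pvs(1), of c] in \<open>simp add: mult.assoc\<close>)
qed

subsection \<open>Weighted least squares\<close>

text \<open>The square root of the weight sits inside \<open>L2_set\<close>, so that Minkowski's
  inequality is inherited; for positive weights the square is the form of
  \<open>collocation_error\<close>.\<close>

definition wnorm :: "(nat \<Rightarrow> real) \<Rightarrow> nat set \<Rightarrow> (nat \<Rightarrow> complex) \<Rightarrow> real" where
  "wnorm w J y = L2_set (\<lambda>j. sqrt (w j) * cmod (y j)) J"

definition wip :: "(nat \<Rightarrow> real) \<Rightarrow> nat set \<Rightarrow> (nat \<Rightarrow> complex) \<Rightarrow> (nat \<Rightarrow> complex) \<Rightarrow> complex" where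
  "wip w J f g = (\<Sum>j\<in>J. of_real (w j) * cnj (f j) * g j)"

lemma wip_simps:
  "wip w J f (\<lambda>j. g j + h j) = wip w J f g + wip w J f h"
  "wip w J f (\<lambda>j. g j - h j) = wip w J f g - wip w J f h"
  "wip w J f (\<lambda>j. c * g j) = c * wip w J f g"
  "wip w J (\<lambda>j. g j + h j) f = wip w J g f + wip w J h f"
  "wip w J (\<lambda>j. g j - h j) f = wip w J g f - wip w J h f"
  "wip w J (\<lambda>j. c * g j) f = cnj c * wip w J g f"
  by (simp_all add: wip_def algebra_simps sum.distrib sum_subtractf sum_distrib_left)

lemma wip_commute: "wip w J f g = cnj (wip w J g f)"
  by (simp add: wip_def mult_ac)

lemma wnorm_nonneg [simp]: "wnorm w J y \<ge> 0"
  by (simp add: wnorm_def)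

locale weighted_points =
  fixes w :: "nat \<Rightarrow> real" and J :: "nat set"
  assumes finite_J: "finite J" and w_pos: "j \<in> J \<Longrightarrow> w j > 0"
begin

lemma wnorm_square: "(wnorm w J y)\<^sup>2 = (\<Sum>j\<in>J. w j * (cmod (y j))\<^sup>2)"
  using w_pos by (simp add: wnorm_def L2_set_def sum_nonneg power_mult_distrib less_imp_le)

lemma wip_self: "wip w J y y = of_real ((wnorm w J y)\<^sup>2)"
  unfolding wnorm_square wip_def of_real_sum
proof (rule sum.cong)
  fix j
  show "of_real (w j) * cnj (y j) * y j = complex_of_real (w j * (cmod (y j))\<^sup>2)"
    using complex_norm_square[of "y j"] by (simp add: mult_ac)
qed simp

lemma wnorm_eq_0_iff: "wnorm w J y = 0 \<longleftrightarrow> (\<forall>j\<in>J. y j = 0)"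
  using w_pos by (fastforce simp: wnorm_def L2_set_eq_0_iff[OF finite_J])

lemma wnorm_triangle: "wnorm w J (\<lambda>j. f j + g j) \<le> wnorm w J f + wnorm w J g"
proof -
  have "wnorm w J (\<lambda>j. f j + g j) \<le> L2_set (\<lambda>j. sqrt (w j) * cmod (f j) + sqrt (w j) * cmod (g j)) J"
    unfolding wnorm_def using w_pos
    by (intro L2_set_mono) (auto simp: distrib_left[symmetric] less_imp_le intro!: mult_left_mono norm_triangle_ineq)
  also have "\<dots> \<le> wnorm w J f + wnorm w J g"
    unfolding wnorm_def by (rule L2_set_triangle_ineq)
  finally show ?thesis .
qed

lemma wnorm_sum: "finite A \<Longrightarrow> wnorm w J (\<lambda>j. \<Sum>k\<in>A. f k j) \<le> (\<Sum>k\<in>A. wnorm w J (f k))"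
proof (induction A rule: finite_induct)
  case empty
  then show ?case using wnorm_eq_0_iff[of "\<lambda>j. 0"] by simp
next
  case (insert k A)
  then show ?case
    using wnorm_triangle[of "f k" "\<lambda>j. \<Sum>k\<in>A. f k j"] by simp
qed

lemma wnorm_scale: "wnorm w J (\<lambda>j. c * f j) = cmod c * wnorm w J f"
  by (simp add: wnorm_def norm_mult L2_set_right_distrib mult.left_commute)

lemma wnorm_minus_commute: "wnorm w J (\<lambda>j. f j - g j) = wnorm w J (\<lambda>j. g j - f j)"
  by (simp add: wnorm_def norm_minus_commute)

lemma pythagoras:
  assumes "wip w J f g = 0"
  shows "(wnorm w J (\<lambda>j. f j + g j))\<^sup>2 = (wnorm w J f)\<^sup>2 + (wnorm w J g)\<^sup>2"
proof -
  have "wip w J g f = 0" using assms wip_commute[of w J g f] by simp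
  then have "wip w J (\<lambda>j. f j + g j) (\<lambda>j. f j + g j) = wip w J f f + wip w J g g"
    using assms by (simp add: wip_simps)
  then show ?thesis
    by (simp only: wip_self of_real_add[symmetric] of_real_eq_iff)
qed

lemma wip_eq_0: "wnorm w J f = 0 \<Longrightarrow> wip w J f g = 0"
  unfolding wnorm_eq_0_iff by (simp add: wip_def)

text \<open>\<open>T\<close> will be sampling V v at the collocation points. Linearity is relative
  to \<open>U\<close> because it is available only for sufficiently regular distributions.\<close>

definition linear_on :: "pdist set \<Rightarrow> (pdist \<Rightarrow> nat \<Rightarrow> complex) \<Rightarrow> bool" where
  "linear_on U T \<longleftrightarrow> (\<forall>a\<in>U. \<forall>b\<in>U. \<forall>c. T (a + pscale c b) = (\<lambda>j. T a j + c * T b j))"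

lemma linear_on_subset: "linear_on U T \<Longrightarrow> U' \<subseteq> U \<Longrightarrow> linear_on U' T"
  unfolding linear_on_def by blast

lemma linear_on_diff:
  assumes "linear_on U T" "a \<in> U" "b \<in> U"
  shows "T (a - b) = (\<lambda>j. T a j - T b j)"
proof -
  have "T (a + pscale (-1) b) = (\<lambda>j. T a j + (-1) * T b j)"
    using assms unfolding linear_on_def by blast
  then show ?thesis by simp
qed

lemma linear_on_zero: "linear_on U T \<Longrightarrow> a \<in> U \<Longrightarrow> T 0 = (\<lambda>j. 0)"
  using linear_on_diff[of U T a a] by simp

text \<open>Gram-Schmidt step: replacing \<open>b\<close> by \<open>b - p\<close> keeps the span, so
  \<open>v\<close> splits into a part in the span of \<open>B\<close> and a multiple of the new
  vector.\<close>

lemma orthogonal_split: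
  assumes lin: "linear_on (pdist.span (insert b B)) T"
    and p: "p \<in> pdist.span B" and v: "v \<in> pdist.span (insert b B)"
  obtains k v0 where "v0 \<in> pdist.span B" "v = v0 + pscale k (b - p)"
    "T v = (\<lambda>j. T v0 j + k * T (b - p) j)"
proof -
  obtain k where k: "v - pscale k b \<in> pdist.span B"
    using v by (metis pdist.span_breakdown_eq)
  define v0 where "v0 = v - pscale k b + pscale k p"
  have v0: "v0 \<in> pdist.span B"
    unfolding v0_def by (intro pdist.span_add k pdist.span_scale p)
  have eq: "v = v0 + pscale k (b - p)"
    by (simp add: v0_def pdist.scale_right_diff_distrib)
  have sub: "pdist.span B \<subseteq> pdist.span (insert b B)"
    by (intro pdist.span_mono) auto
  have "b - p \<in> pdist.span (insert b B)"
    using subsetD[OF sub p] by (intro pdist.span_diff) (simp_all add: pdist.span_base)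
  then have "T v = (\<lambda>j. T v0 j + k * T (b - p) j)"
    unfolding eq using lin subsetD[OF sub v0] unfolding linear_on_def by blast
  with v0 eq that show ?thesis by blast
qed

text \<open>Gram-Schmidt over the spanning set, where \<open>T\<close> may have a kernel:
  \<open>y\<close> is projected on the samples of the span of \<open>B\<close> and then along
  \<open>b'\<close>, the part of \<open>b\<close> with samples orthogonal to those.\<close>

lemma projection_exists:
  assumes "finite B" "linear_on (pdist.span B) T"
  shows "\<exists>p\<in>pdist.span B. \<forall>v\<in>pdist.span B. wip w J (T v) (\<lambda>j. y j - T p j) = 0"
  using assms
proof (induction B arbitrary: y rule: finite_induct)
  case empty
  then have "T 0 = (\<lambda>j. 0)" by (intro linear_on_zero) auto
  then show ?case by (auto simp: wip_def)
next
  case (insert b B)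
  have sub: "pdist.span B \<subseteq> pdist.span (insert b B)"
    by (intro pdist.span_mono) auto
  note lin = linear_on_subset[OF insert.prems sub]
  obtain q where q: "q \<in> pdist.span B"
    "\<And>v. v \<in> pdist.span B \<Longrightarrow> wip w J (T v) (\<lambda>j. T b j - T q j) = 0"
    using insert.IH[OF lin, of "T b"] by blast
  obtain p0 where p0: "p0 \<in> pdist.span B"
    "\<And>v. v \<in> pdist.span B \<Longrightarrow> wip w J (T v) (\<lambda>j. y j - T p0 j) = 0"
    using insert.IH[OF lin, of y] by blast
  define b' where "b' = b - q"
  have b'_in: "b' \<in> pdist.span (insert b B)"
    unfolding b'_def using subsetD[OF sub q(1)] by (intro pdist.span_diff) (simp_all add: pdist.span_base)
  have Tb': "T b' = (\<lambda>j. T b j - T q j)"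
    unfolding b'_def using subsetD[OF sub q(1)]
    by (intro linear_on_diff[OF insert.prems]) (simp_all add: pdist.span_base)
  have orth: "wip w J (T v) (T b') = 0" if "v \<in> pdist.span B" for v
    using q(2)[OF that] by (simp add: Tb')
  \<comment> \<open>If the samples of \<open>b'\<close> vanish, the quotient is 0 by convention, and
    \<open>wip_eq_0\<close> still gives the equation below.\<close>
  define c where "c = wip w J (T b') y / wip w J (T b') (T b')"
  have c: "c * wip w J (T b') (T b') = wip w J (T b') y"
    using wip_eq_0[of "T b'" y] by (auto simp: c_def wip_self)
  define p where "p = p0 + pscale c b'"
  have p: "p \<in> pdist.span (insert b B)"
    unfolding p_def using p0 sub b'_in by (intro pdist.span_add pdist.span_scale) auto
  have Tp: "T p = (\<lambda>j. T p0 j + c * T b' j)"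
    unfolding p_def using insert.prems subsetD[OF sub p0(1)] b'_in unfolding linear_on_def by blast
  have b'_orth: "wip w J (T b') (\<lambda>j. y j - T p j) = 0"
    using c orth[OF p0(1)] wip_commute[of w J "T b'" "T p0"] by (simp add: Tp wip_simps)
  show ?case
  proof (intro bexI[OF _ p] ballI)
    fix v assume "v \<in> pdist.span (insert b B)"
    then obtain k v0 where v0: "v0 \<in> pdist.span B" "T v = (\<lambda>j. T v0 j + k * T b' j)"
      by (rule orthogonal_split[OF insert.prems q(1), folded b'_def])
    have "wip w J (T v0) (\<lambda>j. y j - T p j) = 0"
      using p0(2)[OF v0(1)] orth[OF v0(1)] by (simp add: Tp wip_simps)
    then show "wip w J (T v) (\<lambda>j. y j - T p j) = 0"
      using b'_orth by (simp add: v0(2) wip_simps(4,6))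
  qed
qed

text \<open>On a finite-dimensional space a definite seminorm dominates every other one. Each new
  vector has samples orthogonal to the previous ones, so Pythagoras bounds both components by the
  whole. \<open>N\<close> will be the H^(2\<alpha>) norm.\<close>

lemma definite_imp_bounded:
  assumes "finite B" "linear_on (pdist.span B) T"
    and "\<And>v. v \<in> pdist.span B \<Longrightarrow> wnorm w J (T v) = 0 \<Longrightarrow> v = 0"
    and N: "\<And>u v. u \<in> pdist.span B \<Longrightarrow> v \<in> pdist.span B \<Longrightarrow> N (u + v) \<le> N u + N v"
      "\<And>u c. u \<in> pdist.span B \<Longrightarrow> N (pscale c u) = cmod c * N u"
      "\<And>u. u \<in> pdist.span B \<Longrightarrow> N u \<ge> (0 :: real)"
  shows "\<exists>c\<ge>0. \<forall>v\<in>pdist.span B. N v \<le> c * wnorm w J (T v)"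
  using assms
proof (induction B rule: finite_induct)
  case empty
  then have "N 0 = 0" using empty.prems(4)[of 0 0] by simp
  then show ?case by auto
next
  case (insert b B)
  note lin = insert.prems(1) and def = insert.prems(2) and N = insert.prems(3-5)
  have sub: "pdist.span B \<subseteq> pdist.span (insert b B)"
    by (intro pdist.span_mono) auto
  have linB: "linear_on (pdist.span B) T"
    by (rule linear_on_subset[OF lin sub])
  have "\<exists>c\<ge>0. \<forall>v\<in>pdist.span B. N v \<le> c * wnorm w J (T v)"
    by (rule insert.IH[OF linB]) (simp_all add: def N subsetD[OF sub])
  then obtain c where c: "c \<ge> 0" "\<And>v. v \<in> pdist.span B \<Longrightarrow> N v \<le> c * wnorm w J (T v)"
    by blast
  obtain q where q: "q \<in> pdist.span B"
    "\<And>v. v \<in> pdist.span B \<Longrightarrow> wip w J (T v) (\<lambda>j. T b j - T q j) = 0"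
    using projection_exists[OF insert.hyps(1) linB, of "T b"] by blast
  define b' where "b' = b - q"
  have b'_in: "b' \<in> pdist.span (insert b B)"
    unfolding b'_def using subsetD[OF sub q(1)] by (intro pdist.span_diff) (simp_all add: pdist.span_base)
  have Tb': "T b' = (\<lambda>j. T b j - T q j)"
    unfolding b'_def using subsetD[OF sub q(1)]
    by (intro linear_on_diff[OF lin]) (simp_all add: pdist.span_base)
  \<comment> \<open>The ratio controls the new direction; when the denominator is 0, definiteness
    forces \<open>b' = 0\<close> and the numerator vanishes too.\<close>
  define d where "d = N b' / wnorm w J (T b')"
  have d: "d \<ge> 0" "N b' = d * wnorm w J (T b')"
  proof -
    show "d \<ge> 0" using N(3)[OF b'_in] by (simp add: d_def)
    show "N b' = d * wnorm w J (T b')"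
    proof (cases "wnorm w J (T b') = 0")
      case True
      then have "b' = 0" by (rule def[OF b'_in])
      then show ?thesis using N(2)[of 0 0] pdist.span_zero True by simp
    qed (simp add: d_def)
  qed
  show ?case
  proof (intro exI[of _ "c + d"] conjI ballI)
    fix v assume "v \<in> pdist.span (insert b B)"
    then obtain k v0 where v0: "v0 \<in> pdist.span B" "v = v0 + pscale k b'" "T v = (\<lambda>j. T v0 j + k * T b' j)"
      by (rule orthogonal_split[OF lin q(1), folded b'_def])
    have "wip w J (T v0) (\<lambda>j. k * T b' j) = 0"
      using q(2)[OF v0(1)] by (simp add: Tb' wip_simps(3))
    then have sq: "(wnorm w J (T v))\<^sup>2 = (wnorm w J (T v0))\<^sup>2 + (wnorm w J (\<lambda>j. k * T b' j))\<^sup>2"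
      unfolding v0(3) by (rule pythagoras)
    have le: "wnorm w J (T v0) \<le> wnorm w J (T v)" "cmod k * wnorm w J (T b') \<le> wnorm w J (T v)"
      unfolding wnorm_scale[symmetric] by (rule power2_le_imp_le; simp add: sq)+
    have "N v \<le> N v0 + N (pscale k b')"
      unfolding v0(2) using v0(1) sub b'_in by (intro N pdist.span_scale) auto
    also have "N (pscale k b') = d * (cmod k * wnorm w J (T b'))"
      using N(2)[OF b'_in] d(2) by simp
    also have "N v0 + d * (cmod k * wnorm w J (T b')) \<le> c * wnorm w J (T v) + d * wnorm w J (T v)"
      by (intro add_mono order_trans[OF c(2)[OF v0(1)]] mult_left_mono c(1) d(1) le)
    finally show "N v \<le> (c + d) * wnorm w J (T v)" by (simp add: distrib_right)
  qed (use c d in simp)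
qed

context
  fixes B T and y :: "nat \<Rightarrow> complex"
  assumes B: "finite B" and lin: "linear_on (pdist.span B) T"
begin

text \<open>The projection \<open>p\<close> of the data leaves a residual orthogonal to all samples,
  which turns minimisation into Pythagoras.\<close>

lemma minimiser_orthogonal:
  "\<exists>p\<in>pdist.span B. \<forall>v\<in>pdist.span B.
    (wnorm w J (\<lambda>j. T v j - y j))\<^sup>2 = (wnorm w J (\<lambda>j. T v j - T p j))\<^sup>2 + (wnorm w J (\<lambda>j. T p j - y j))\<^sup>2"
proof -
  obtain p where p: "p \<in> pdist.span B"
    "\<And>v. v \<in> pdist.span B \<Longrightarrow> wip w J (T v) (\<lambda>j. y j - T p j) = 0"
    using projection_exists[OF B lin, of y] by blast
  have "(wnorm w J (\<lambda>j. T v j - y j))\<^sup>2 = (wnorm w J (\<lambda>j. T v j - T p j))\<^sup>2 + (wnorm w J (\<lambda>j. T p j - y j))\<^sup>2"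
    if v: "v \<in> pdist.span B" for v
  proof -
    have "wip w J (\<lambda>j. T v j - T p j) (\<lambda>j. T p j - y j) = 0"
      using p(2)[OF v] p(2)[OF p(1)] by (simp add: wip_simps)
    from pythagoras[OF this] show ?thesis by simp
  qed
  with p(1) show ?thesis by (intro bexI[of _ p] ballI)
qed

lemma minimiser_exists:
  "\<exists>p\<in>pdist.span B. \<forall>v\<in>pdist.span B. wnorm w J (\<lambda>j. T p j - y j) \<le> wnorm w J (\<lambda>j. T v j - y j)"
proof -
  obtain p where p: "p \<in> pdist.span B"
    "\<forall>v\<in>pdist.span B.
      (wnorm w J (\<lambda>j. T v j - y j))\<^sup>2 = (wnorm w J (\<lambda>j. T v j - T p j))\<^sup>2 + (wnorm w J (\<lambda>j. T p j - y j))\<^sup>2"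
    using minimiser_orthogonal by (rule bexE)
  have "wnorm w J (\<lambda>j. T p j - y j) \<le> wnorm w J (\<lambda>j. T v j - y j)" if "v \<in> pdist.span B" for v
    by (rule power2_le_imp_le) (simp_all add: bspec[OF p(2) that])
  with p(1) show ?thesis by (intro bexI[of _ p] ballI)
qed

context
  fixes v
  assumes v: "v \<in> pdist.span B"
    and min: "\<And>u. u \<in> pdist.span B \<Longrightarrow> wnorm w J (\<lambda>j. T v j - y j) \<le> wnorm w J (\<lambda>j. T u j - y j)"
begin

text \<open>A minimiser may differ from the projection \<open>p\<close>, but its samples agree with
  those of \<open>p\<close>: otherwise \<open>p\<close> would have a smaller residual. Hence the
  identity transfers from \<open>p\<close> to \<open>v\<close>.\<close>

lemma minimiser_pythagoras:
  assumes u: "u \<in> pdist.span B"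
  shows "(wnorm w J (\<lambda>j. T u j - y j))\<^sup>2 = (wnorm w J (\<lambda>j. T u j - T v j))\<^sup>2 + (wnorm w J (\<lambda>j. T v j - y j))\<^sup>2"
proof -
  obtain p where p: "p \<in> pdist.span B"
    "\<forall>v\<in>pdist.span B.
      (wnorm w J (\<lambda>j. T v j - y j))\<^sup>2 = (wnorm w J (\<lambda>j. T v j - T p j))\<^sup>2 + (wnorm w J (\<lambda>j. T p j - y j))\<^sup>2"
    using minimiser_orthogonal by (rule bexE)
  have "(wnorm w J (\<lambda>j. T v j - y j))\<^sup>2 \<le> (wnorm w J (\<lambda>j. T p j - y j))\<^sup>2"
    using min[OF p(1)] by (intro power_mono) auto
  then have "wnorm w J (\<lambda>j. T v j - T p j) = 0"
    using bspec[OF p(2) v] by simp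
  then have eq: "T v j = T p j" if "j \<in> J" for j
    using that by (simp add: wnorm_eq_0_iff)
  have "wnorm w J (\<lambda>j. T u j - T v j) = wnorm w J (\<lambda>j. T u j - T p j)"
    "wnorm w J (\<lambda>j. T v j - y j) = wnorm w J (\<lambda>j. T p j - y j)"
    unfolding wnorm_def by (auto intro!: L2_set_cong simp: eq)
  then show ?thesis using bspec[OF p(2) u] by simp
qed

text \<open>The samples of \<open>v - u\<close> are a leg of the right triangle whose hypotenuse is
  the residual of \<open>u\<close>, so the constant is 1.\<close>

lemma minimiser_quasi_optimal:
  assumes "u \<in> pdist.span B"
  shows "wnorm w J (T (v - u)) \<le> wnorm w J (\<lambda>j. y j - T u j)"
proof -
  have "wnorm w J (T (v - u)) = wnorm w J (\<lambda>j. T u j - T v j)"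
    unfolding linear_on_diff[OF lin v assms] by (rule wnorm_minus_commute)
  also have "\<dots> \<le> wnorm w J (\<lambda>j. T u j - y j)"
    by (rule power2_le_imp_le) (simp_all add: minimiser_pythagoras[OF assms])
  also have "\<dots> = wnorm w J (\<lambda>j. y j - T u j)"
    by (rule wnorm_minus_commute)
  finally show ?thesis .
qed

lemma minimiser_unique:
  assumes "\<And>u. u \<in> pdist.span B \<Longrightarrow> wnorm w J (T u) = 0 \<Longrightarrow> u = 0"
    and u: "u \<in> pdist.span B"
    and "wnorm w J (\<lambda>j. T u j - y j) \<le> wnorm w J (\<lambda>j. T v j - y j)"
  shows "u = v"
proof -
  have "(wnorm w J (\<lambda>j. T u j - y j))\<^sup>2 \<le> (wnorm w J (\<lambda>j. T v j - y j))\<^sup>2"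
    using assms(3) by (intro power_mono) auto
  then have "wnorm w J (\<lambda>j. T u j - T v j) = 0"
    using minimiser_pythagoras[OF u] by simp
  then have "u - v = 0"
    using u v by (intro assms(1) pdist.span_diff) (simp_all add: linear_on_diff[OF lin])
  then show ?thesis by simp
qed

text \<open>Subtracting a vector with vanishing samples from a minimiser gives another minimiser, so
  uniqueness for one set of data makes the seminorm definite.\<close>

lemma unique_minimiser_definite:
  assumes "\<And>u. u \<in> pdist.span B \<Longrightarrow>
      (\<And>u'. u' \<in> pdist.span B \<Longrightarrow> wnorm w J (\<lambda>j. T u j - y j) \<le> wnorm w J (\<lambda>j. T u' j - y j)) \<Longrightarrow> u = v"
    and u: "u \<in> pdist.span B" "wnorm w J (T u) = 0"
  shows "u = 0"
proof -
  have vu: "v - u \<in> pdist.span B" using u v by (intro pdist.span_diff)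
  have "wnorm w J (\<lambda>j. T (v - u) j - y j) = wnorm w J (\<lambda>j. T v j - y j)"
    using u(2) unfolding wnorm_eq_0_iff linear_on_diff[OF lin v u(1)]
    by (auto simp: wnorm_def intro!: L2_set_cong)
  with min have "v - u = v" by (intro assms(1) vu) simp
  then show ?thesis by simp
qed

end

end

end

subsection \<open>Sampling inequality\<close>

lemma L2_set_group:
  assumes "finite A"
  shows "L2_set (\<lambda>k. L2_set f {n\<in>A. g n = k}) (g ` A) = L2_set f A"
proof -
  have "(\<Sum>k\<in>g ` A. (L2_set f {n\<in>A. g n = k})\<^sup>2) = (\<Sum>n\<in>A. (f n)\<^sup>2)"
    unfolding L2_set_def
    using sum.image_gen[OF assms, of "\<lambda>n. (f n)\<^sup>2" g] by (simp add: sum_nonneg)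
  then show ?thesis by (simp add: L2_set_def)
qed

text \<open>The l^2 norm of the block weights, which Cauchy-Schwarz over the blocks produces as a
  factor when \<sigma> > 1/2.\<close>

definition bracket_const :: "real \<Rightarrow> real" where
  "bracket_const \<sigma> = sqrt (\<Sum>\<^sub>\<infinity>k. bracket k powr (- (2 * \<sigma>)))"

lemma L2_set_bracket_le:
  assumes "\<sigma> > 1/2" "finite A"
  shows "L2_set (\<lambda>k. bracket k powr (- \<sigma>)) A \<le> bracket_const \<sigma>"
proof -
  have "(bracket k powr (- \<sigma>))\<^sup>2 = bracket k powr (- (2 * \<sigma>))" for k
    by (simp add: power2_eq_square flip: powr_add)
  moreover have "(\<Sum>k\<in>A. bracket k powr (- (2 * \<sigma>))) \<le> (\<Sum>\<^sub>\<infinity>k. bracket k powr (- (2 * \<sigma>)))"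
    using assms by (intro finite_sum_le_infsum summable_bracket) auto
  ultimately show ?thesis
    by (simp add: L2_set_def bracket_const_def)
qed

lemma bracket_const_nonneg [simp]: "bracket_const \<sigma> \<ge> 0"
  unfolding bracket_const_def by (auto intro!: infsum_nonneg)

text \<open>A frequency n in block k satisfies |k| \<le> |n| / L + 1, so a weight in the block index
  is controlled by a weight in n at scale L. The 2 absorbs the summand 1 into the maximum.\<close>

lemma bracket_div_le:
  assumes "L \<ge> 1" "\<sigma> \<ge> 0"
  shows "bracket (n div L) powr \<sigma> \<le> 2 powr \<sigma> * (1 + real_of_int L powr (- \<sigma>) * bracket n powr \<sigma>)"
proof -
  have L: "real_of_int L > 0" using assms by simp
  have div: "real_of_int n = real_of_int L * real_of_int (n div L) + real_of_int (n mod L)"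
    by (metis mult_div_mod_eq of_int_add of_int_mult)
  have mod: "0 \<le> real_of_int (n mod L)" "real_of_int (n mod L) \<le> L"
    using assms(1) pos_mod_bound[of L n] by (auto simp: less_imp_le)
  have "real_of_int L * \<bar>real_of_int (n div L)\<bar> = \<bar>real_of_int L * real_of_int (n div L)\<bar>"
    using L by (simp add: abs_mult)
  also have "\<dots> \<le> \<bar>real_of_int n\<bar> + L" using div mod by linarith
  also have "\<dots> \<le> bracket n + L" by (simp add: bracket_def)
  finally have "\<bar>real_of_int (n div L)\<bar> \<le> bracket n / L + 1"
    using L by (simp add: field_simps)
  moreover have "bracket n / L \<ge> 0" using L by simp
  ultimately have "bracket (n div L) \<le> 2 * max 1 (bracket n / L)"
    unfolding bracket_def[of "n div L"] by (simp add: max_def)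
  then have "bracket (n div L) powr \<sigma> \<le> (2 * max 1 (bracket n / L)) powr \<sigma>"
    using assms(2) by (intro powr_mono2) auto
  also have "\<dots> = 2 powr \<sigma> * (max 1 (bracket n / L)) powr \<sigma>"
    by (rule powr_mult)
  also have "(max 1 (bracket n / L)) powr \<sigma> \<le> 1 + (bracket n / L) powr \<sigma>"
    by (simp add: max_def)
  also have "(bracket n / L) powr \<sigma> = real_of_int L powr (- \<sigma>) * bracket n powr \<sigma>"
    using L by (simp add: powr_divide powr_minus field_simps)
  finally show ?thesis by simp
qed

context weighted_points
begin

lemma block_bound:
  fixes L k :: int and x :: "nat \<Rightarrow> real"
  assumes L: "L \<ge> 1" and A: "finite A"
    and hyp: "\<And>a. wnorm w J (\<lambda>j. \<Sum>i\<in>{0..<L}. a i * fexp i (x j)) \<le> C * L2_set (\<lambda>i. cmod (a i)) {0..<L}"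
  shows "wnorm w J (\<lambda>j. \<Sum>n\<in>{n\<in>A. n div L = k}. c n * fexp n (x j))
    \<le> C * L2_set (\<lambda>n. cmod (c n)) {n\<in>A. n div L = k}"
proof -
  \<comment> \<open>Frequencies of the block missing from \<open>A\<close> get coefficient 0, so
    that the hypothesis on full polynomials over \<open>{0..<L}\<close> applies.\<close>
  define a where "a i = (if k * L + i \<in> A then c (k * L + i) else 0)" for i
  have re: "(\<Sum>n\<in>{n\<in>A. n div L = k}. g n) = (\<Sum>i\<in>{0..<L}. if k * L + i \<in> A then g (k * L + i) else 0)"
    for g :: "int \<Rightarrow> 'b::comm_monoid_add"
  proof -
    have "(\<Sum>n\<in>{n\<in>A. n div L = k}. g n) = (\<Sum>i\<in>{i\<in>{0..<L}. k * L + i \<in> A}. g (k * L + i))"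
    proof (rule sum.reindex_bij_witness[of _ "\<lambda>i. k * L + i" "\<lambda>n. n - k * L"])
      fix n assume "n \<in> {n\<in>A. n div L = k}"
      then have "n \<in> A" "k = n div L" by auto
      then show "n - k * L \<in> {i\<in>{0..<L}. k * L + i \<in> A}"
        using L by (simp add: minus_div_mult_eq_mod pos_mod_bound)
    next
      fix i assume "i \<in> {i\<in>{0..<L}. k * L + i \<in> A}"
      then show "k * L + i \<in> {n\<in>A. n div L = k}"
        using L by (auto simp: div_pos_pos_trivial)
    qed auto
    then show ?thesis
      using sum.inter_filter[of "{0..<L}" "\<lambda>i. g (k * L + i)" "\<lambda>i. k * L + i \<in> A"] by simp
  qed
  have "(\<Sum>n\<in>{n\<in>A. n div L = k}. c n * fexp n t) = fexp (k * L) t * (\<Sum>i\<in>{0..<L}. a i * fexp i t)" for t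
    unfolding re sum_distrib_left a_def by (rule sum.cong) (auto simp: fexp_add)
  then have "wnorm w J (\<lambda>j. \<Sum>n\<in>{n\<in>A. n div L = k}. c n * fexp n (x j)) =
      wnorm w J (\<lambda>j. \<Sum>i\<in>{0..<L}. a i * fexp i (x j))"
    by (simp add: wnorm_def norm_mult)
  also have "\<dots> \<le> C * L2_set (\<lambda>i. cmod (a i)) {0..<L}" by (rule hyp)
  also have "L2_set (\<lambda>i. cmod (a i)) {0..<L} = L2_set (\<lambda>n. cmod (c n)) {n\<in>A. n div L = k}"
    unfolding L2_set_def re a_def by (intro arg_cong[where f=sqrt] sum.cong) auto
  finally show ?thesis .
qed

text \<open>The triangle inequality leaves the plain sum of the block norms, not their l^2 sum.
  Inserting \<open>bracket k powr \<sigma>\<close> and its inverse makes Cauchy-Schwarz applicable,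
  and \<open>bracket_div_le\<close> converts the inserted weight into the H^0 and H^\<sigma>
  norms.\<close>

lemma sampling_inequality:
  fixes L :: int and x :: "nat \<Rightarrow> real"
  assumes L: "L \<ge> 1" and C: "C \<ge> 0"
    and hyp: "\<And>a. wnorm w J (\<lambda>j. \<Sum>i\<in>{0..<L}. a i * fexp i (x j)) \<le> C * L2_set (\<lambda>i. cmod (a i)) {0..<L}"
    and \<sigma>: "\<sigma> > 1/2" and f: "f \<in> sobolev_space \<sigma>"
  shows "wnorm w J (\<lambda>j. point_value f (x j)) \<le>
    C * (bracket_const \<sigma> * 2 powr \<sigma>) * (sobolev_norm 0 f + real_of_int L powr (- \<sigma>) * sobolev_norm \<sigma> f)"
    (is "_ \<le> ?R")
proof -
  let ?c = "fourier_coeff f" and ?l = "real_of_int L powr (- \<sigma>)"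
  have f0: "f \<in> sobolev_space 0" using sobolev_mono(1)[OF f, of 0] \<sigma> by simp
  have fin: "wnorm w J (\<lambda>j. \<Sum>n\<in>A. ?c n * fexp n (x j)) \<le> ?R" if A: "finite A" for A
  proof -
    let ?K = "(\<lambda>n. n div L) ` A" and ?A = "\<lambda>k. {n\<in>A. n div L = k}"
    have "wnorm w J (\<lambda>j. \<Sum>n\<in>A. ?c n * fexp n (x j)) =
        wnorm w J (\<lambda>j. \<Sum>k\<in>?K. \<Sum>n\<in>?A k. ?c n * fexp n (x j))"
      by (subst sum.image_gen[OF A, of _ "\<lambda>n. n div L"]) (rule refl)
    also have "\<dots> \<le> (\<Sum>k\<in>?K. wnorm w J (\<lambda>j. \<Sum>n\<in>?A k. ?c n * fexp n (x j)))"
      using A by (intro wnorm_sum) simp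
    also have "\<dots> \<le> (\<Sum>k\<in>?K. C * L2_set (\<lambda>n. cmod (?c n)) (?A k))"
      by (intro sum_mono block_bound L A hyp)
    also have "\<dots> = C * (\<Sum>k\<in>?K. L2_set (\<lambda>n. cmod (?c n)) (?A k))"
      by (simp add: sum_distrib_left)
    finally have 1: "wnorm w J (\<lambda>j. \<Sum>n\<in>A. ?c n * fexp n (x j)) \<le> C * (\<Sum>k\<in>?K. L2_set (\<lambda>n. cmod (?c n)) (?A k))" .
    have 2: "(\<Sum>k\<in>?K. L2_set (\<lambda>n. cmod (?c n)) (?A k)) \<le>
        bracket_const \<sigma> * (2 powr \<sigma> * (sobolev_norm 0 f + ?l * sobolev_norm \<sigma> f))"
    proof -
      let ?b = "\<lambda>k. 2 powr \<sigma> * (L2_set (wcoeff 0 f) (?A k) + ?l * L2_set (wcoeff \<sigma> f) (?A k))"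
      have le: "L2_set (\<lambda>n. cmod (?c n)) (?A k) \<le> bracket k powr (- \<sigma>) * ?b k" for k
      proof -
        have "bracket k powr \<sigma> * L2_set (\<lambda>n. cmod (?c n)) (?A k) = L2_set (\<lambda>n. bracket k powr \<sigma> * cmod (?c n)) (?A k)"
          by (simp add: L2_set_right_distrib)
        also have "\<dots> \<le> L2_set (\<lambda>n. 2 powr \<sigma> * wcoeff 0 f n + (2 powr \<sigma> * ?l) * wcoeff \<sigma> f n) (?A k)"
        proof (rule L2_set_mono)
          fix n assume "n \<in> ?A k"
          then have "bracket k powr \<sigma> * cmod (?c n) \<le> (2 powr \<sigma> * (1 + ?l * bracket n powr \<sigma>)) * cmod (?c n)"
            using bracket_div_le[OF L, of \<sigma> n] \<sigma> by (intro mult_right_mono) auto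
          then show "bracket k powr \<sigma> * cmod (?c n) \<le> 2 powr \<sigma> * wcoeff 0 f n + (2 powr \<sigma> * ?l) * wcoeff \<sigma> f n"
            using bracket_pos[of n] by (simp add: wcoeff_def less_imp_neq[THEN not_sym] algebra_simps)
        qed simp
        also have "\<dots> \<le> L2_set (\<lambda>n. 2 powr \<sigma> * wcoeff 0 f n) (?A k) + L2_set (\<lambda>n. (2 powr \<sigma> * ?l) * wcoeff \<sigma> f n) (?A k)"
          by (rule L2_set_triangle_ineq)
        also have "\<dots> = ?b k"
          by (simp add: L2_set_right_distrib distrib_left mult.assoc)
        finally have "bracket k powr (- \<sigma>) * (bracket k powr \<sigma> * L2_set (\<lambda>n. cmod (?c n)) (?A k)) \<le> bracket k powr (- \<sigma>) * ?b k"
          by (intro mult_left_mono) auto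
        moreover have "bracket k powr (- \<sigma>) * (bracket k powr \<sigma> * z) = z" for z
          using bracket_pos[of k]
          by (simp add: less_imp_neq[THEN not_sym] flip: mult.assoc powr_add)
        ultimately show ?thesis by (simp only:)
      qed
      have "(\<Sum>k\<in>?K. L2_set (\<lambda>n. cmod (?c n)) (?A k)) \<le> (\<Sum>k\<in>?K. \<bar>bracket k powr (- \<sigma>)\<bar> * \<bar>?b k\<bar>)"
      proof (rule sum_mono)
        fix k
        show "L2_set (\<lambda>n. cmod (?c n)) (?A k) \<le> \<bar>bracket k powr (- \<sigma>)\<bar> * \<bar>?b k\<bar>"
          unfolding abs_mult[symmetric] by (rule order_trans[OF le abs_ge_self])
      qed
      also have "\<dots> \<le> L2_set (\<lambda>k. bracket k powr (- \<sigma>)) ?K * L2_set ?b ?K"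
        by (rule L2_set_mult_ineq)
      also have "\<dots> \<le> bracket_const \<sigma> * (2 powr \<sigma> * (sobolev_norm 0 f + ?l * sobolev_norm \<sigma> f))"
      proof (rule mult_mono)
        show "L2_set (\<lambda>k. bracket k powr (- \<sigma>)) ?K \<le> bracket_const \<sigma>"
          using A by (intro L2_set_bracket_le \<sigma>) auto
        have "L2_set ?b ?K = 2 powr \<sigma> * L2_set (\<lambda>k. L2_set (wcoeff 0 f) (?A k) + ?l * L2_set (wcoeff \<sigma> f) (?A k)) ?K"
          by (simp add: L2_set_right_distrib)
        also have "\<dots> \<le> 2 powr \<sigma> * (L2_set (\<lambda>k. L2_set (wcoeff 0 f) (?A k)) ?K + L2_set (\<lambda>k. ?l * L2_set (wcoeff \<sigma> f) (?A k)) ?K)"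
          by (intro mult_left_mono L2_set_triangle_ineq) auto
        also have "\<dots> = 2 powr \<sigma> * (L2_set (wcoeff 0 f) A + ?l * L2_set (wcoeff \<sigma> f) A)"
          by (subst L2_set_right_distrib[symmetric]) (simp_all add: L2_set_group[OF A])
        also have "\<dots> \<le> 2 powr \<sigma> * (sobolev_norm 0 f + ?l * sobolev_norm \<sigma> f)"
          by (intro mult_left_mono add_mono L2_set_wcoeff_le f f0 A) auto
        finally show "L2_set ?b ?K \<le> 2 powr \<sigma> * (sobolev_norm 0 f + ?l * sobolev_norm \<sigma> f)" .
      qed auto
      finally show ?thesis .
    qed
    from order_trans[OF 1 mult_left_mono[OF 2 C]] show ?thesis by (simp only: mult.assoc)
  qed
  \<comment> \<open>Only finitely many points are sampled, so convergence of the Fourier series at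
    each of them carries the bound from finite frequency sets over to \<open>f\<close>.\<close>
  have "((\<lambda>A. wnorm w J (\<lambda>j. \<Sum>n\<in>A. ?c n * fexp n (x j))) \<longlongrightarrow> wnorm w J (\<lambda>j. point_value f (x j)))
      (finite_subsets_at_top UNIV)"
    unfolding wnorm_def L2_set_def
    using fseries_has_sum[OF summable_fourier_coeff[OF f \<sigma>]]
    by (intro tendsto_intros) (simp add: has_sum_def point_value_eq_fseries[OF summable_fourier_coeff[OF f \<sigma>]])
  then show ?thesis
    by (rule tendsto_upperbound) (auto intro!: eventually_finite_subsets_at_top_weakI fin)
qed

end

subsection \<open>Oversampled collocation\<close>

definition point_weight :: "(nat \<Rightarrow> real) \<Rightarrow> nat \<Rightarrow> real" where
  "point_weight x j = (x (j + 1) - x (j - 1)) / 2"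

text \<open>All points lie in [0,1), so the periodic neighbours continue the strict order:
  \<open>x 0\<close> is negative and \<open>x (M + 1)\<close> is at least 1.\<close>

lemma weighted_points_collocation:
  assumes "collocation_points M x"
  shows "weighted_points (point_weight x) {1..M}"
proof
  fix j assume j: "j \<in> {1..M}"
  have mono: "x i < x k" if "i \<in> {1..M}" "k \<in> {1..M}" "i < k" for i k
    using assms that by (auto simp: collocation_points_def strict_mono_on_def)
  have "x i \<le> x k" if "i \<in> {1..M}" "k \<in> {1..M}" "i \<le> k" for i k
    using mono[OF that(1,2)] that(3) by (cases "i = k") auto
  then have ends: "0 \<le> x 1" "x 1 \<le> x j" "x j \<le> x M" "x M < 1"
    using assms j by (auto simp: collocation_points_def)
  have "x (j - 1) < x j"
  proof (cases "j = 1")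
    case True
    then show ?thesis using assms ends by (simp add: collocation_points_def)
  next
    case False
    then show ?thesis using j by (intro mono) auto
  qed
  moreover have "x j < x (j + 1)"
  proof (cases "j = M")
    case True
    then show ?thesis using assms ends by (simp add: collocation_points_def)
  next
    case False
    then show ?thesis using j by (intro mono) auto
  qed
  ultimately show "point_weight x j > 0" by (simp add: point_weight_def)
qed simp

definition discrete_norm :: "nat \<Rightarrow> (nat \<Rightarrow> real) \<Rightarrow> pdist \<Rightarrow> real" where
  "discrete_norm M x f = wnorm (point_weight x) {1..M} (\<lambda>j. point_value f (x j))"

lemma discrete_pairing_self:
  assumes "collocation_points M x"
  shows "discrete_pairing M x f f = of_real ((discrete_norm M x f)\<^sup>2)"
  unfolding discrete_norm_def weighted_points.wip_self[OF weighted_points_collocation[OF assms], symmetric]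
  by (simp add: discrete_pairing_def wip_def point_weight_def)

lemma collocation_error_eq:
  assumes "collocation_points M x"
  shows "collocation_error V M x f v =
    (wnorm (point_weight x) {1..M} (\<lambda>j. point_value (V v) (x j) - point_value f (x j)))\<^sup>2"
  unfolding weighted_points.wnorm_square[OF weighted_points_collocation[OF assms]]
  by (simp add: collocation_error_def point_weight_def)

lemma least_squares_iff:
  assumes "collocation_points M x"
  shows "least_squares_collocation V S M x f v \<longleftrightarrow> v \<in> S \<and> (\<forall>w\<in>S.
    wnorm (point_weight x) {1..M} (\<lambda>j. point_value (V v) (x j) - point_value f (x j))
      \<le> wnorm (point_weight x) {1..M} (\<lambda>j. point_value (V w) (x j) - point_value f (x j)))"
  unfolding least_squares_collocation_def collocation_error_eq[OF assms]
  by (simp add: power2_le_iff_abs_le)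

section \<open>Sampling under the hypotheses of the theorem\<close>

locale collocation_setting =
  fixes \<alpha> l m r s :: real
    and V :: "pdist \<Rightarrow> pdist"
    and S :: "nat \<Rightarrow> pdist set"
    and h \<E> :: "nat \<Rightarrow> real"
    and M :: "nat \<Rightarrow> nat"
    and x :: "nat \<Rightarrow> nat \<Rightarrow> real"
  assumes iso: "sobolev_isomorphism \<alpha> V"
    and spaces: "boundary_element_spaces m h S"
    and approx: "approximation_property l m h S"
    and inverse: "inverse_property m h S"
    and l_gt: "l - 2 * \<alpha> > 1/2"
    and points: "\<forall>N\<ge>1. N \<le> M N \<and> collocation_points (M N) (x N)"
    and r_pos: "r > 0" and s_pos: "s > 0" and rs_less: "max r s < m + 1/2 - 2 * \<alpha>"
    and \<E>_pos: "\<forall>N\<ge>1. \<E> N > 0"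
    and quadrature: "\<forall>N\<ge>1. \<forall>f\<in>sobolev_space (max r s). \<forall>g\<in>sobolev_space (max r s).
      cmod (l2_pairing g f - discrete_pairing (M N) (x N) g f)
        \<le> \<E> N * (sobolev_norm r f * sobolev_norm s g + sobolev_norm s f * sobolev_norm r g)"
    and limit: "(\<lambda>N. \<E> N * h N powr (- (r + s))) \<longlonglongrightarrow> 0"
begin

abbreviation "dnorm N \<equiv> discrete_norm (M N) (x N)"

lemma h_pos: "N \<ge> 1 \<Longrightarrow> h N > 0"
  and S_subset: "N \<ge> 1 \<Longrightarrow> S N \<subseteq> sobolev_space (m + 1/2)"
  using spaces by (auto simp: boundary_element_spaces_def)

lemma S_sobolev: "N \<ge> 1 \<Longrightarrow> w \<in> S N \<Longrightarrow> t \<le> m + 1/2 \<Longrightarrow> w \<in> sobolev_space t"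
  using S_subset sobolev_mono(1) by blast

text \<open>Positive dimension makes the basis finite and nonempty; \<open>h_bounded\<close> tests
  the inverse property on one of its nonzero elements.\<close>

lemma S_basis:
  assumes "N \<ge> 1"
  obtains B where "finite B" "S N = pdist.span B" "B \<noteq> {}" "0 \<notin> B"
proof -
  have sub: "pdist.subspace (S N)" and dim: "pdist.dim (S N) = N"
    using spaces assms by (auto simp: boundary_element_spaces_def)
  obtain B where B: "B \<subseteq> S N" "pdist.independent B" "S N \<subseteq> pdist.span B" "card B = pdist.dim (S N)"
    by (rule pdist.basis_exists)
  have "finite B" "B \<noteq> {}" using B(4) dim assms by (auto intro: card_ge_0_finite)
  moreover have "S N = pdist.span B" using B sub pdist.span_minimal by blast
  moreover have "0 \<notin> B" using B(2) pdist.dependent_zero by blast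
  ultimately show ?thesis using that by blast
qed

lemma weighted_points_N: "N \<ge> 1 \<Longrightarrow> weighted_points (point_weight (x N)) {1..M N}"
  using points weighted_points_collocation by blast

lemma quadrature_self:
  assumes N: "N \<ge> 1" and f: "f \<in> sobolev_space (max r s)"
  shows "\<bar>(sobolev_norm 0 f)\<^sup>2 - (dnorm N f)\<^sup>2\<bar> \<le> 2 * \<E> N * (sobolev_norm r f * sobolev_norm s f)"
proof -
  have "f \<in> sobolev_space 0" using sobolev_mono(1)[OF f] r_pos by simp
  then have "l2_pairing f f - discrete_pairing (M N) (x N) f f =
      of_real ((sobolev_norm 0 f)\<^sup>2 - (dnorm N f)\<^sup>2)"
    using points N by (simp add: l2_pairing_self discrete_pairing_self)
  then have "cmod (l2_pairing f f - discrete_pairing (M N) (x N) f f) =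
      \<bar>(sobolev_norm 0 f)\<^sup>2 - (dnorm N f)\<^sup>2\<bar>"
    by (simp only: norm_of_real)
  then show ?thesis using quadrature N f by (fastforce simp: algebra_simps)
qed

text \<open>For \<open>max r s \<le> 1/2\<close> the quadrature estimate would bound the point evaluation at \<open>x\<^sub>1\<close> on
  trigonometric polynomials by the norm of \<open>H\<^bsup>1/2\<^esup>\<close>, which fails for \<open>\<Sum>n\<le>K. e\<^sub>n(t - x\<^sub>1) / n\<close>.\<close>

lemma max_rs_gt: "max r s > 1/2"
proof (rule ccontr)
  assume "\<not> max r s > 1/2"
  then have small: "r \<le> 1/2" "s \<le> 1/2" by auto
  \<comment> \<open>A single point set yields the contradiction, here that of N = 1.\<close>
  have M: "1 \<le> M 1" using points by auto
  interpret weighted_points "point_weight (x 1)" "{1..M 1}" by (rule weighted_points_N) simp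
  define w1 where "w1 = point_weight (x 1) 1"
  have w1: "w1 > 0" unfolding w1_def using M by (intro w_pos) auto
  have E: "\<E> 1 > 0" using \<E>_pos by simp
  have bound: "harm K \<le> (1 + 2 * \<E> 1) / w1" if "K \<ge> 1" for K
  proof -
    define A where "A = int ` {1..K}"
    \<comment> \<open>The phases align all terms at \<open>x 1 1\<close>, so the point value there
      is \<open>harm K\<close>, while the squared H^(1/2) norm is also
      \<open>harm K\<close>.\<close>
    define a where "a n = fexp (- n) (x 1 1) / of_int n" for n
    define p where "p = trig_dist a A"
    have A: "finite A" by (simp add: A_def)
    have p: "p \<in> sobolev_space t" for t unfolding p_def by (rule trig_dist_sobolev[OF A])
    have "sobolev_norm (1/2) p = sqrt (\<Sum>n\<in>A. (bracket n powr (1/2) * cmod (a n))\<^sup>2)"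
      unfolding p_def trig_dist_sobolev(2)[OF A] L2_set_def ..
    also have "(\<Sum>n\<in>A. (bracket n powr (1/2) * cmod (a n))\<^sup>2) = (\<Sum>k\<in>{1..K}. inverse (real k))"
      unfolding A_def by (subst sum.reindex)
        (auto intro!: sum.cong simp: a_def bracket_def norm_divide powr_half_sqrt power_mult_distrib power2_eq_square field_simps)
    finally have "sobolev_norm (1/2) p = sqrt (harm K)" by (simp add: harm_def)
    moreover have "(harm K :: real) \<ge> 0" by (rule harm_nonneg)
    ultimately have norm: "sobolev_norm (1/2) p * sobolev_norm (1/2) p = harm K" by simp
    have pv: "point_value p (x 1 1) = of_real (harm K)"
      unfolding p_def point_value_trig_dist[OF A] unfolding A_def
      by (subst sum.reindex) (auto simp: a_def harm_def divide_inverse_commute mult.assoc intro!: sum.cong)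
    have "w1 * (harm K)\<^sup>2 = w1 * (cmod (point_value p (x 1 1)))\<^sup>2"
      by (simp only: pv norm_of_real power2_abs)
    also have "\<dots> \<le> (\<Sum>j\<in>{1..M 1}. point_weight (x 1) j * (cmod (point_value p (x 1 j)))\<^sup>2)"
      unfolding w1_def
      by (rule member_le_sum[of 1 _ "\<lambda>j. point_weight (x 1) j * (cmod (point_value p (x 1 j)))\<^sup>2"])
         (use M w_pos in \<open>auto simp: less_imp_le\<close>)
    also have "\<dots> = (dnorm 1 p)\<^sup>2" by (simp only: discrete_norm_def wnorm_square)
    also have "\<dots> \<le> (sobolev_norm 0 p)\<^sup>2 + 2 * \<E> 1 * (sobolev_norm r p * sobolev_norm s p)"
      using quadrature_self[of 1 p] p by simp
    \<comment> \<open>With r and s at most 1/2, all three norms are bounded by the H^(1/2) norm: the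
      right side grows like \<open>harm K\<close>, the left like its square.\<close>
    also have "\<dots> \<le> harm K + 2 * \<E> 1 * harm K"
      unfolding norm[symmetric] power2_eq_square using E small
      by (intro add_mono mult_left_mono mult_mono sobolev_mono(2) p) auto
    finally have "harm K * (w1 * harm K) \<le> harm K * (1 + 2 * \<E> 1)"
      by (simp add: power2_eq_square algebra_simps)
    moreover have "(harm K :: real) > 0" using that by (intro harm_pos) auto
    ultimately have "w1 * harm K \<le> 1 + 2 * \<E> 1" by (simp only: mult_le_cancel_left_pos)
    then show ?thesis using w1 by (simp add: field_simps)
  qed
  define C where "C = (1 + 2 * \<E> 1) / w1"
  obtain K :: nat where K: "real K > exp C" using reals_Archimedean2 by blast
  then have "K \<ge> 1" using exp_gt_zero[of C] by (cases K) auto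
  have "C < ln (real K)" using K exp_gt_zero[of C] by (metis less_trans ln_exp ln_less_cancel_iff)
  also have "\<dots> \<le> ln (real K + 1)" using \<open>K \<ge> 1\<close> by simp
  also have "\<dots> \<le> harm K" by (rule ln_le_harm)
  also have "\<dots> \<le> C" unfolding C_def by (rule bound[OF \<open>K \<ge> 1\<close>])
  finally show False by simp
qed

text \<open>The H^(m - 1/2) norm is at most the H^(m + 1/2) norm, so the inverse estimate with
  factor C h^(-1) on a nonzero element of \<open>S N\<close> forces |C| h^(-1) \<ge> 1.\<close>

lemma h_bounded: "\<exists>H\<ge>0. \<forall>N\<ge>1. h N \<le> H"
proof -
  obtain C where C: "\<And>N w. N \<ge> 1 \<Longrightarrow> w \<in> S N \<Longrightarrow>
      sobolev_norm (m + 1/2) w \<le> C * h N powr (m - 1/2 - (m + 1/2)) * sobolev_norm (m - 1/2) w"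
    using inverse[unfolded inverse_property_def, rule_format, of "m - 1/2" "m + 1/2"] by auto
  have "h N \<le> \<bar>C\<bar>" if N: "N \<ge> 1" for N
  proof -
    obtain B where B: "finite B" "S N = pdist.span B" "B \<noteq> {}" "0 \<notin> B" by (rule S_basis[OF N])
    then obtain w where w: "w \<in> S N" "w \<noteq> 0" using pdist.span_base by blast
    have w': "w \<in> sobolev_space (m + 1/2)" using S_subset[OF N] w by blast
    define n where "n = sobolev_norm (m + 1/2) w"
    have n: "n > 0"
      using sobolev_norm_eq_0[OF w'] w(2) sobolev_norm_nonneg[of "m + 1/2" w] unfolding n_def
      by (metis less_eq_real_def)
    have "n \<le> C * h N powr (- 1) * sobolev_norm (m - 1/2) w"
      using C[OF N w(1)] by (simp add: n_def)
    also have "\<dots> \<le> \<bar>C\<bar> * h N powr (- 1) * n"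
      unfolding n_def by (intro mult_mono sobolev_mono(2) w') auto
    finally have "n * 1 \<le> n * (\<bar>C\<bar> * h N powr (- 1))" by (simp add: mult_ac)
    then have "1 \<le> \<bar>C\<bar> * h N powr (- 1)" using n by (simp only: mult_le_cancel_left_pos)
    then show ?thesis using h_pos[OF N] by (simp add: powr_minus field_simps)
  qed
  then show ?thesis by (intro exI[of _ "\<bar>C\<bar>"]) auto
qed

text \<open>The bound covers every N \<ge> 1 and not only large N, since the limit hypothesis enters
  only through boundedness of the sequence.\<close>

lemma sampling:
  assumes "\<sigma> > 1/2"
  shows "\<exists>C\<ge>0. \<forall>N\<ge>1. \<forall>f\<in>sobolev_space \<sigma>.
    dnorm N f \<le> C * (sobolev_norm 0 f + h N powr \<sigma> * sobolev_norm \<sigma> f)"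
proof -
  obtain H where H: "H \<ge> 0" "\<And>N. N \<ge> 1 \<Longrightarrow> h N \<le> H" using h_bounded by blast
  obtain G where G: "\<And>N. \<bar>\<E> N * h N powr (- (r + s))\<bar> \<le> G"
    using convergent_imp_Bseq[OF convergentI[OF limit]] by (auto simp: Bseq_def)
  have G0: "G \<ge> 0" using G[of 0] by linarith
  define C where "C = sqrt (1 + 2 * (G * (1 + H) powr (r + s)))"
  have C: "C \<ge> 0" using G0 by (simp add: C_def)
  have "dnorm N f \<le> C * (bracket_const \<sigma> * 2 powr \<sigma>) * (sobolev_norm 0 f + h N powr \<sigma> * sobolev_norm \<sigma> f)"
    if N: "N \<ge> 1" and f: "f \<in> sobolev_space \<sigma>" for N f
  proof -
    interpret weighted_points "point_weight (x N)" "{1..M N}" by (rule weighted_points_N[OF N])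
    have h: "h N > 0" "h N \<le> H" using h_pos H N by auto
    \<comment> \<open>Rounding up yields the factor h^\<sigma> in the second term; because of
      \<open>h N \<le> H\<close> it overshoots 1/h by at most the factor 1 + H, which keeps \<E>
      L^(r + s) bounded.\<close>
    define L where "L = \<lceil>1 / h N\<rceil>"
    have L: "L \<ge> 1" "1 / h N \<le> real_of_int L" "real_of_int L \<le> (1 + H) / h N"
    proof -
      have "1 / h N > 0" using h by simp
      then show "L \<ge> 1" unfolding L_def by linarith
      show "1 / h N \<le> real_of_int L" unfolding L_def by linarith
      have "real_of_int L \<le> 1 / h N + 1" unfolding L_def by linarith
      also have "\<dots> \<le> (1 + H) / h N" using h by (simp add: field_simps)
      finally show "real_of_int L \<le> (1 + H) / h N" .
    qed
    have EL: "\<E> N * real_of_int L powr (r + s) \<le> G * (1 + H) powr (r + s)"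
    proof -
      have "real_of_int L powr (r + s) \<le> ((1 + H) / h N) powr (r + s)"
        using L r_pos s_pos by (intro powr_mono2) auto
      also have "\<dots> = h N powr (- (r + s)) * (1 + H) powr (r + s)"
        using h H by (simp add: powr_divide powr_minus field_simps del: minus_add_distrib)
      finally have "\<E> N * real_of_int L powr (r + s) \<le> \<E> N * (h N powr (- (r + s)) * (1 + H) powr (r + s))"
        using \<E>_pos N by (intro mult_left_mono) (auto simp: less_imp_le)
      also have "\<dots> = (\<E> N * h N powr (- (r + s))) * (1 + H) powr (r + s)" by (simp only: mult.assoc)
      also have "\<dots> \<le> G * (1 + H) powr (r + s)"
        using G[of N] by (intro mult_right_mono) auto
      finally show ?thesis .
    qed
    have hyp: "wnorm (point_weight (x N)) {1..M N} (\<lambda>j. \<Sum>i\<in>{0..<L}. a i * fexp i (x N j))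
        \<le> C * L2_set (\<lambda>i. cmod (a i)) {0..<L}" for a
    proof -
      define p where "p = trig_dist a {0..<L}"
      have p: "p \<in> sobolev_space t" for t unfolding p_def by (rule trig_dist_sobolev) simp
      have norm: "sobolev_norm t p = L2_set (\<lambda>n. bracket n powr t * cmod (a n)) {0..<L}" for t
        unfolding p_def by (rule trig_dist_sobolev) simp
      define n0 where "n0 = L2_set (\<lambda>i. cmod (a i)) {0..<L}"
      have n0: "sobolev_norm 0 p = n0" "n0 \<ge> 0"
        unfolding norm n0_def using bracket_pos by (auto simp: less_imp_neq[THEN not_sym])
      have nt: "sobolev_norm t p \<le> real_of_int L powr t * n0" if "t > 0" for t
        unfolding norm n0_def L2_set_right_distrib[OF powr_ge_zero]
        using that L(1) by (intro L2_set_mono) (auto simp: bracket_def intro!: mult_right_mono powr_mono2)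
      have "(dnorm N p)\<^sup>2 \<le> (sobolev_norm 0 p)\<^sup>2 + 2 * \<E> N * (sobolev_norm r p * sobolev_norm s p)"
        using quadrature_self[OF N p] by linarith
      also have "\<dots> \<le> n0\<^sup>2 + 2 * \<E> N * ((real_of_int L powr r * n0) * (real_of_int L powr s * n0))"
        using \<E>_pos N n0 by (intro add_mono mult_left_mono mult_mono nt r_pos s_pos) (auto simp: less_imp_le)
      also have "\<dots> = (1 + 2 * (\<E> N * real_of_int L powr (r + s))) * n0\<^sup>2"
        by (simp add: powr_add power2_eq_square algebra_simps)
      also have "\<dots> \<le> (1 + 2 * (G * (1 + H) powr (r + s))) * n0\<^sup>2"
        using EL by (intro mult_right_mono) auto
      also have "\<dots> = (C * n0)\<^sup>2" using G0 by (simp add: C_def power_mult_distrib)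
      finally have "dnorm N p \<le> C * n0" by (rule power2_le_imp_le) (simp add: C n0)
      then show ?thesis by (simp add: discrete_norm_def p_def point_value_trig_dist n0_def)
    qed
    have "dnorm N f \<le> C * (bracket_const \<sigma> * 2 powr \<sigma>) *
        (sobolev_norm 0 f + real_of_int L powr (- \<sigma>) * sobolev_norm \<sigma> f)"
      unfolding discrete_norm_def by (rule sampling_inequality[OF L(1) C hyp assms f])
    also have "real_of_int L powr (- \<sigma>) \<le> h N powr \<sigma>"
    proof -
      have "real_of_int L powr (- \<sigma>) \<le> (1 / h N) powr (- \<sigma>)"
        using L(2) h assms by (intro powr_mono2') auto
      also have "\<dots> = h N powr \<sigma>" using h by (simp add: powr_divide powr_minus)
      finally show ?thesis .
    qed
    finally show ?thesis
      using C by (simp add: mult_left_mono mult_right_mono)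
  qed
  then show ?thesis
    using C by (intro exI[of _ "C * (bracket_const \<sigma> * 2 powr \<sigma>)"]) auto
qed

section \<open>The operator V on the Sobolev scale and on the boundary element spaces\<close>

lemma V_linear: "V (u + v) = V u + V v" "V (u - v) = V u - V v" "V (pscale c u) = pscale c (V u)"
proof -
  interpret V: Vector_Spaces.linear pscale pscale V
    using iso by (simp add: sobolev_isomorphism_def)
  show "V (u + v) = V u + V v" "V (u - v) = V u - V v" "V (pscale c u) = pscale c (V u)"
    by (rule V.add V.diff V.scale)+
qed

text \<open>The isomorphism is used at s = t + \<alpha>, so that V lowers the order by 2\<alpha>;
  the constants are made nonnegative for later multiplication.\<close>

lemma V_sobolev: "u \<in> sobolev_space (t + 2 * \<alpha>) \<Longrightarrow> V u \<in> sobolev_space t"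
  and V_bounded: "\<exists>c\<ge>0. \<forall>u\<in>sobolev_space (t + 2 * \<alpha>). sobolev_norm t (V u) \<le> c * sobolev_norm (t + 2 * \<alpha>) u"
  and V_bounded_below: "\<exists>c\<ge>0. \<forall>u\<in>sobolev_space (t + 2 * \<alpha>). sobolev_norm (t + 2 * \<alpha>) u \<le> c * sobolev_norm t (V u)"
proof -
  have eq: "t + \<alpha> + \<alpha> = t + 2 * \<alpha>" "t + \<alpha> - \<alpha> = t" by auto
  have iso': "bij_betw V (sobolev_space (t + 2 * \<alpha>)) (sobolev_space t)"
    "\<exists>c. \<forall>u\<in>sobolev_space (t + 2 * \<alpha>). sobolev_norm t (V u) \<le> c * sobolev_norm (t + 2 * \<alpha>) u"
    "\<exists>c. \<forall>u\<in>sobolev_space (t + 2 * \<alpha>). sobolev_norm (t + 2 * \<alpha>) u \<le> c * sobolev_norm t (V u)"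
    using iso[unfolded sobolev_isomorphism_def, THEN conjunct2, rule_format, of "t + \<alpha>", unfolded eq]
    by simp_all
  show "u \<in> sobolev_space (t + 2 * \<alpha>) \<Longrightarrow> V u \<in> sobolev_space t"
    using iso'(1) by (auto dest: bij_betwE)
  have weaken: "\<exists>c\<ge>0. \<forall>u\<in>U. f u \<le> c * g u"
    if "\<exists>c. \<forall>u\<in>U. f u \<le> c * g u" "\<And>u. g u \<ge> 0" for U and f g :: "pdist \<Rightarrow> real"
  proof -
    from that(1) obtain c where "\<And>u. u \<in> U \<Longrightarrow> f u \<le> c * g u" by blast
    then have "f u \<le> \<bar>c\<bar> * g u" if "u \<in> U" for u
      using mult_right_mono[OF abs_ge_self[of c] \<open>g u \<ge> 0\<close>] that by force
    then show ?thesis by (intro exI[of _ "\<bar>c\<bar>"]) auto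
  qed
  show "\<exists>c\<ge>0. \<forall>u\<in>sobolev_space (t + 2 * \<alpha>). sobolev_norm t (V u) \<le> c * sobolev_norm (t + 2 * \<alpha>) u"
    "\<exists>c\<ge>0. \<forall>u\<in>sobolev_space (t + 2 * \<alpha>). sobolev_norm (t + 2 * \<alpha>) u \<le> c * sobolev_norm t (V u)"
    by (rule weaken[OF iso'(2)], simp) (rule weaken[OF iso'(3)], simp)
qed

lemma V_S_sobolev:
  assumes "N \<ge> 1" "w \<in> S N" "t \<le> max r s"
  shows "V w \<in> sobolev_space t"
  using assms rs_less by (intro V_sobolev S_sobolev) auto

text \<open>The inverse property between 2\<alpha> and t + 2\<alpha>, transported by V with its
  upper bound at order t and its lower bound at order 0. The restriction on t keeps t + 2\<alpha>
  below m + 1/2.\<close>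

lemma V_inverse:
  assumes t: "0 < t" "t \<le> max r s"
  shows "\<exists>K\<ge>0. \<forall>N\<ge>1. \<forall>w\<in>S N. sobolev_norm t (V w) \<le> K * h N powr (- t) * sobolev_norm 0 (V w)"
proof -
  obtain c where c: "c \<ge> 0" "\<And>u. u \<in> sobolev_space (t + 2 * \<alpha>) \<Longrightarrow> sobolev_norm t (V u) \<le> c * sobolev_norm (t + 2 * \<alpha>) u"
    using V_bounded by blast
  obtain d where d: "d \<ge> 0" "\<And>u. u \<in> sobolev_space (2 * \<alpha>) \<Longrightarrow> sobolev_norm (2 * \<alpha>) u \<le> d * sobolev_norm 0 (V u)"
    using V_bounded_below[of 0] by auto
  obtain C where C: "\<And>N w. N \<ge> 1 \<Longrightarrow> w \<in> S N \<Longrightarrow>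
      sobolev_norm (t + 2 * \<alpha>) w \<le> C * h N powr (2 * \<alpha> - (t + 2 * \<alpha>)) * sobolev_norm (2 * \<alpha>) w"
    using inverse[unfolded inverse_property_def, rule_format, of "2 * \<alpha>" "t + 2 * \<alpha>"] t rs_less by auto
  have "sobolev_norm t (V w) \<le> (c * \<bar>C\<bar> * d) * h N powr (- t) * sobolev_norm 0 (V w)"
    if N: "N \<ge> 1" and w: "w \<in> S N" for N w
  proof -
    have "sobolev_norm t (V w) \<le> c * sobolev_norm (t + 2 * \<alpha>) w"
      using t rs_less by (intro c S_sobolev[OF N w]) auto
    also have "\<dots> \<le> c * (\<bar>C\<bar> * h N powr (- t) * sobolev_norm (2 * \<alpha>) w)"
    proof (rule mult_left_mono[OF _ c(1)])
      have "sobolev_norm (t + 2 * \<alpha>) w \<le> C * h N powr (- t) * sobolev_norm (2 * \<alpha>) w"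
        using C[OF N w] by simp
      also have "\<dots> \<le> \<bar>C\<bar> * h N powr (- t) * sobolev_norm (2 * \<alpha>) w"
        by (intro mult_right_mono) auto
      finally show "sobolev_norm (t + 2 * \<alpha>) w \<le> \<bar>C\<bar> * h N powr (- t) * sobolev_norm (2 * \<alpha>) w" .
    qed
    also have "\<dots> \<le> c * (\<bar>C\<bar> * h N powr (- t) * (d * sobolev_norm 0 (V w)))"
      using t rs_less by (intro mult_left_mono c(1) d(2) S_sobolev[OF N w]) auto
    finally show ?thesis by (simp add: mult_ac)
  qed
  then show ?thesis using c(1) d(1) by (intro exI[of _ "c * \<bar>C\<bar> * d"]) auto
qed

text \<open>The inverse estimates for r and s together cost h^(-(r + s)), precisely the factor in
  the limit hypothesis, so on V \<open>S N\<close> the quadrature error becomes a small multiple of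
  the squared L^2 norm.\<close>

lemma coercive:
  "\<exists>c\<ge>0. \<forall>\<^sub>F N in sequentially. \<forall>w\<in>S N. sobolev_norm (2 * \<alpha>) w \<le> c * dnorm N (V w)"
proof -
  obtain Kr where Kr: "Kr \<ge> 0" "\<And>N w. N \<ge> 1 \<Longrightarrow> w \<in> S N \<Longrightarrow>
      sobolev_norm r (V w) \<le> Kr * h N powr (- r) * sobolev_norm 0 (V w)"
    using V_inverse[OF r_pos] by auto
  obtain Ks where Ks: "Ks \<ge> 0" "\<And>N w. N \<ge> 1 \<Longrightarrow> w \<in> S N \<Longrightarrow>
      sobolev_norm s (V w) \<le> Ks * h N powr (- s) * sobolev_norm 0 (V w)"
    using V_inverse[OF s_pos] by auto
  obtain d where d: "d \<ge> 0" "\<And>u. u \<in> sobolev_space (2 * \<alpha>) \<Longrightarrow> sobolev_norm (2 * \<alpha>) u \<le> d * sobolev_norm 0 (V u)"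
    using V_bounded_below[of 0] by auto
  have "(\<lambda>N. (2 * Kr * Ks) * (\<E> N * h N powr (- (r + s)))) \<longlonglongrightarrow> (2 * Kr * Ks) * 0"
    by (intro tendsto_mult_left limit)
  \<comment> \<open>The value 3/4 leaves a quarter of the square, hence the factor 2 in
    \<open>n \<le> 2 * dnorm N (V w)\<close>.\<close>
  then have "\<forall>\<^sub>F N in sequentially. (2 * Kr * Ks) * (\<E> N * h N powr (- (r + s))) < 3/4"
    by (rule order_tendstoD) simp
  moreover have "\<forall>\<^sub>F N in sequentially. N \<ge> (1::nat)" by (rule eventually_ge_at_top)
  ultimately have "\<forall>\<^sub>F N in sequentially. \<forall>w\<in>S N. sobolev_norm (2 * \<alpha>) w \<le> (2 * d) * dnorm N (V w)"
  proof eventually_elim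
    case (elim N)
    note N = elim(2)
    show ?case
    proof
      fix w assume w: "w \<in> S N"
      define n where "n = sobolev_norm 0 (V w)"
      have n: "n \<ge> 0" by (simp add: n_def)
      have "n\<^sup>2 - (dnorm N (V w))\<^sup>2 \<le> 2 * \<E> N * (sobolev_norm r (V w) * sobolev_norm s (V w))"
        using quadrature_self[OF N V_S_sobolev[OF N w order_refl]] unfolding n_def by linarith
      also have "\<dots> \<le> 2 * \<E> N * ((Kr * h N powr (- r) * n) * (Ks * h N powr (- s) * n))"
        using \<E>_pos N Kr Ks n w unfolding n_def
        by (intro mult_left_mono mult_mono) (auto simp: less_imp_le)
      also have "\<dots> = (2 * Kr * Ks) * (\<E> N * h N powr (- (r + s))) * n\<^sup>2"
      proof -
        have "h N powr (- (r + s)) = h N powr (- r) * h N powr (- s)"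
          by (simp flip: powr_add)
        then show ?thesis by (simp only: power2_eq_square mult_ac)
      qed
      also have "\<dots> \<le> 3/4 * n\<^sup>2"
        using elim(1) by (intro mult_right_mono) auto
      finally have "n\<^sup>2 \<le> (2 * dnorm N (V w))\<^sup>2" by (simp add: power_mult_distrib)
      then have "n \<le> 2 * dnorm N (V w)"
        by (rule power2_le_imp_le) (simp add: discrete_norm_def)
      then have "d * n \<le> d * (2 * dnorm N (V w))" using d(1) by (rule mult_left_mono)
      moreover have "sobolev_norm (2 * \<alpha>) w \<le> d * n"
        unfolding n_def using rs_less r_pos by (intro d(2) S_sobolev[OF N w]) auto
      ultimately show "sobolev_norm (2 * \<alpha>) w \<le> (2 * d) * dnorm N (V w)" by simp
    qed
  qed
  then show ?thesis using d(1) by (intro exI[of _ "2 * d"]) auto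
qed

section \<open>Solvability and definiteness of the discrete least-squares problem\<close>

definition samples :: "nat \<Rightarrow> pdist \<Rightarrow> nat \<Rightarrow> complex" where
  "samples N v j = point_value (V v) (x N j)"

lemma dnorm_V: "dnorm N (V v) = wnorm (point_weight (x N)) {1..M N} (samples N v)"
  by (simp add: discrete_norm_def samples_def[abs_def])

text \<open>Here \<open>max_rs_gt\<close> enters: V w lies in H^(max r s) for w in
  \<open>S N\<close>, so it has point values depending linearly on w.\<close>

lemma samples_linear:
  assumes "N \<ge> 1"
  shows "weighted_points.linear_on (S N) (samples N)"
proof -
  interpret weighted_points "point_weight (x N)" "{1..M N}" by (rule weighted_points_N[OF assms])
  have "samples N (a + pscale c b) = (\<lambda>j. samples N a j + c * samples N b j)"
    if "a \<in> S N" "b \<in> S N" for a b c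
    using V_S_sobolev[OF assms that(1) order_refl] V_S_sobolev[OF assms that(2) order_refl] max_rs_gt
    unfolding samples_def[abs_def] V_linear
    by (simp add: point_value_linear[of _ "max r s"] sobolev_pscale)
  then show ?thesis by (simp add: linear_on_def)
qed

lemma least_squares_iff_samples:
  assumes "N \<ge> 1"
  shows "least_squares_collocation V (S N) (M N) (x N) (V u) v \<longleftrightarrow> v \<in> S N \<and> (\<forall>w\<in>S N.
    wnorm (point_weight (x N)) {1..M N} (\<lambda>j. samples N v j - samples N u j)
      \<le> wnorm (point_weight (x N)) {1..M N} (\<lambda>j. samples N w j - samples N u j))"
  using points assms by (simp add: least_squares_iff samples_def)

text \<open>Existence comes from projection; the bound makes the sampled seminorm definite on
  \<open>S N\<close>, which gives uniqueness.\<close>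

lemma unique_solvability:
  assumes N: "N \<ge> 1" and bound: "\<And>w. w \<in> S N \<Longrightarrow> sobolev_norm (2 * \<alpha>) w \<le> c * dnorm N (V w)"
  shows "\<exists>!v. least_squares_collocation V (S N) (M N) (x N) (V u) v"
proof -
  interpret weighted_points "point_weight (x N)" "{1..M N}" by (rule weighted_points_N[OF N])
  obtain B where B: "finite B" "S N = pdist.span B" by (rule S_basis[OF N])
  note lin = samples_linear[OF N, unfolded B(2)]
  note iff = least_squares_iff_samples[OF N, unfolded B(2)]
  have def: "w = 0" if "w \<in> pdist.span B" "wnorm (point_weight (x N)) {1..M N} (samples N w) = 0" for w
  proof (rule sobolev_norm_eq_0)
    have w: "w \<in> S N" using that(1) B(2) by simp
    show "w \<in> sobolev_space (2 * \<alpha>)" using rs_less r_pos by (intro S_sobolev[OF N w]) auto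
    show "sobolev_norm (2 * \<alpha>) w = 0"
    proof (rule antisym)
      show "sobolev_norm (2 * \<alpha>) w \<le> 0"
        using bound[OF w] that(2) by (simp add: dnorm_V)
    qed simp
  qed
  obtain v where v: "v \<in> pdist.span B" "\<forall>w\<in>pdist.span B.
    wnorm (point_weight (x N)) {1..M N} (\<lambda>j. samples N v j - samples N u j)
      \<le> wnorm (point_weight (x N)) {1..M N} (\<lambda>j. samples N w j - samples N u j)"
    using minimiser_exists[OF B(1) lin, of "samples N u"] by (rule bexE)
  show ?thesis
    unfolding B(2)
  proof (rule ex1I[of _ v])
    show "least_squares_collocation V (pdist.span B) (M N) (x N) (V u) v"
      unfolding iff using v by (rule conjI)
  next
    fix v' assume "least_squares_collocation V (pdist.span B) (M N) (x N) (V u) v'"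
    note v' = this[unfolded iff]
    show "v' = v"
      by (rule minimiser_unique[OF B(1) lin v(1) bspec[OF v(2)] def conjunct1[OF v'] bspec[OF conjunct2[OF v'] v(1)]])
  qed
qed

text \<open>Uniqueness for a single \<open>u\<close> makes sampling injective on \<open>S N\<close>,
  and finite dimension then gives a constant that concerns N only.\<close>

lemma unique_imp_bounded:
  assumes N: "N \<ge> 1" and ex1: "\<exists>!v. least_squares_collocation V (S N) (M N) (x N) (V u) v"
  shows "\<exists>c\<ge>0. \<forall>w\<in>S N. sobolev_norm (2 * \<alpha>) w \<le> c * dnorm N (V w)"
proof -
  interpret weighted_points "point_weight (x N)" "{1..M N}" by (rule weighted_points_N[OF N])
  obtain B where B: "finite B" "S N = pdist.span B" by (rule S_basis[OF N])
  note lin = samples_linear[OF N, unfolded B(2)]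
  note iff = least_squares_iff_samples[OF N, unfolded B(2)]
  obtain v where v: "least_squares_collocation V (S N) (M N) (x N) (V u) v"
    and uniq: "\<forall>v'. least_squares_collocation V (S N) (M N) (x N) (V u) v' \<longrightarrow> v' = v"
    using ex1 by (rule ex1E)
  note v' = v[unfolded B(2) iff]
  have def: "w = 0" if "w \<in> pdist.span B" "wnorm (point_weight (x N)) {1..M N} (samples N w) = 0" for w
  proof (rule unique_minimiser_definite[OF B(1) lin conjunct1[OF v'] bspec[OF conjunct2[OF v']] _ that])
    fix u' assume "u' \<in> pdist.span B" "\<And>w. w \<in> pdist.span B \<Longrightarrow>
      wnorm (point_weight (x N)) {1..M N} (\<lambda>j. samples N u' j - samples N u j)
        \<le> wnorm (point_weight (x N)) {1..M N} (\<lambda>j. samples N w j - samples N u j)"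
    then show "u' = v"
      by (intro uniq[rule_format, unfolded B(2) iff] conjI ballI)
  qed
  have sob: "w \<in> sobolev_space (2 * \<alpha>)" if "w \<in> pdist.span B" for w
    using that rs_less r_pos unfolding B(2)[symmetric] by (intro S_sobolev[OF N]) auto
  have "\<exists>c\<ge>0. \<forall>w\<in>pdist.span B. sobolev_norm (2 * \<alpha>) w
      \<le> c * wnorm (point_weight (x N)) {1..M N} (samples N w)"
    by (rule definite_imp_bounded[OF B(1) lin def])
       (simp_all add: sobolev_add(2)[OF sob sob] sobolev_pscale(2)[OF sob])
  then show ?thesis by (simp add: B(2) dnorm_V)
qed

section \<open>The error estimate\<close>

text \<open>The stability constant \<open>c\<close> remains a parameter, because for large N it
  comes from \<open>coercive\<close> and for small N from \<open>unique_imp_bounded\<close>;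
  \<open>A\<close> is common to all N and u.\<close>

lemma error_bound:
  "\<exists>A\<ge>0. \<forall>N\<ge>1. \<forall>c\<ge>0. (\<forall>w\<in>S N. sobolev_norm (2 * \<alpha>) w \<le> c * dnorm N (V w)) \<longrightarrow>
    (\<forall>u\<in>sobolev_space l. \<forall>v. least_squares_collocation V (S N) (M N) (x N) (V u) v \<longrightarrow>
      sobolev_norm (2 * \<alpha>) (v - u) \<le> (c + 1) * A * h N powr (l - 2 * \<alpha>) * sobolev_norm l u)"
proof -
  \<comment> \<open>At most l - 2\<alpha>, so that V u lies in H^\<sigma>; at most max r s, so that
    \<sigma> + 2\<alpha> < m + 1/2 and V w lies there as well.\<close>
  define \<sigma> where "\<sigma> = min (l - 2 * \<alpha>) (max r s)"
  have \<sigma>: "\<sigma> > 1/2" "\<sigma> \<le> l - 2 * \<alpha>" "\<sigma> \<le> max r s"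
    using l_gt max_rs_gt by (auto simp: \<sigma>_def)
  obtain K where K: "K \<ge> 0" "\<And>N f. N \<ge> 1 \<Longrightarrow> f \<in> sobolev_space \<sigma> \<Longrightarrow>
      dnorm N f \<le> K * (sobolev_norm 0 f + h N powr \<sigma> * sobolev_norm \<sigma> f)"
    using sampling[OF \<sigma>(1)] by blast
  obtain c0 where c0: "c0 \<ge> 0" "\<And>u. u \<in> sobolev_space (2 * \<alpha>) \<Longrightarrow> sobolev_norm 0 (V u) \<le> c0 * sobolev_norm (2 * \<alpha>) u"
    using V_bounded[of 0] by auto
  obtain c1 where c1: "c1 \<ge> 0" "\<And>u. u \<in> sobolev_space (\<sigma> + 2 * \<alpha>) \<Longrightarrow> sobolev_norm \<sigma> (V u) \<le> c1 * sobolev_norm (\<sigma> + 2 * \<alpha>) u"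
    using V_bounded[of \<sigma>] by auto
  have m: "2 * \<alpha> < m + 1/2" "\<sigma> + 2 * \<alpha> < m + 1/2" using rs_less r_pos \<sigma> by auto
  \<comment> \<open>One approximant must be good in H^(2\<alpha>) and in H^(\<sigma> + 2\<alpha>),
    hence the simultaneous form of the approximation property. The threshold 2\<alpha> - 1 is just a
    number below both orders.\<close>
  have "2 * \<alpha> - 1 < m + 1/2" using m by simp
  then obtain a where a: "\<And>N v. N \<ge> 1 \<Longrightarrow> v \<in> sobolev_space l \<Longrightarrow> \<exists>w\<in>S N. \<forall>t. 2 * \<alpha> - 1 < t \<and> t \<le> l \<and> t < m + 1/2 \<longrightarrow>
      sobolev_norm t (v - w) \<le> a t * h N powr (l - t) * sobolev_norm l v"
    using approx[unfolded approximation_property_def, THEN conjunct2, rule_format, of "2 * \<alpha> - 1" l] by auto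
  define a0 a1 where "a0 = \<bar>a (2 * \<alpha>)\<bar>" and "a1 = \<bar>a (\<sigma> + 2 * \<alpha>)\<bar>"
  \<comment> \<open>\<open>K * (c0 * a0 + c1 * a1)\<close> bounds the sampled error of the
    approximant, to be multiplied by \<open>c\<close>; the last \<open>a0\<close> is its own error
    in H^(2\<alpha>).\<close>
  define A where "A = K * (c0 * a0 + c1 * a1) + a0"
  have A: "0 \<le> K * (c0 * a0 + c1 * a1)" "a0 \<ge> 0"
    using K c0 c1 by (auto simp: a0_def a1_def)
  have main: "sobolev_norm (2 * \<alpha>) (v - u) \<le> (c + 1) * A * h N powr (l - 2 * \<alpha>) * sobolev_norm l u"
    if N: "N \<ge> 1" and c: "c \<ge> 0" "\<forall>w\<in>S N. sobolev_norm (2 * \<alpha>) w \<le> c * dnorm N (V w)"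
      and u: "u \<in> sobolev_space l" and v: "least_squares_collocation V (S N) (M N) (x N) (V u) v"
    for N c u v
  proof -
    interpret weighted_points "point_weight (x N)" "{1..M N}" by (rule weighted_points_N[OF N])
    obtain B where B: "finite B" "S N = pdist.span B" by (rule S_basis[OF N])
    note lin = samples_linear[OF N, unfolded B(2)]
  note iff = least_squares_iff_samples[OF N, unfolded B(2)]
    define e where "e = h N powr (l - 2 * \<alpha>) * sobolev_norm l u"
    have e: "e \<ge> 0" by (simp add: e_def)
    obtain w where w: "w \<in> S N" and approx_w: "\<And>t. 2 * \<alpha> - 1 < t \<Longrightarrow> t \<le> l \<Longrightarrow> t < m + 1/2 \<Longrightarrow>
        sobolev_norm t (u - w) \<le> a t * h N powr (l - t) * sobolev_norm l u"
      using a[OF N u] by blast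
    have vS: "v \<in> S N" using v by (simp add: least_squares_collocation_def)
    have w0: "sobolev_norm (2 * \<alpha>) (u - w) \<le> a0 * e"
    proof -
      have "sobolev_norm (2 * \<alpha>) (u - w) \<le> a (2 * \<alpha>) * e"
        using approx_w[of "2 * \<alpha>"] m l_gt by (simp add: e_def mult.assoc)
      also have "\<dots> \<le> a0 * e" using e by (intro mult_right_mono) (auto simp: a0_def)
      finally show ?thesis .
    qed
    have w1: "h N powr \<sigma> * sobolev_norm (\<sigma> + 2 * \<alpha>) (u - w) \<le> a1 * e"
    proof -
      have "h N powr \<sigma> * sobolev_norm (\<sigma> + 2 * \<alpha>) (u - w) \<le>
          h N powr \<sigma> * (a (\<sigma> + 2 * \<alpha>) * h N powr (l - (\<sigma> + 2 * \<alpha>)) * sobolev_norm l u)"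
        using m \<sigma> by (intro mult_left_mono approx_w) auto
      also have "\<dots> = a (\<sigma> + 2 * \<alpha>) * (h N powr \<sigma> * h N powr (l - (\<sigma> + 2 * \<alpha>)) * sobolev_norm l u)"
        by (simp only: mult_ac)
      also have "h N powr \<sigma> * h N powr (l - (\<sigma> + 2 * \<alpha>)) = h N powr (l - 2 * \<alpha>)"
        by (simp flip: powr_add)
      also have "a (\<sigma> + 2 * \<alpha>) * (h N powr (l - 2 * \<alpha>) * sobolev_norm l u) \<le> a1 * e"
        unfolding e_def[symmetric] using e by (intro mult_right_mono) (auto simp: a1_def)
      finally show ?thesis .
    qed
    have u1: "u \<in> sobolev_space (\<sigma> + 2 * \<alpha>)" using \<sigma> by (intro sobolev_mono(1)[OF u]) auto
    have w': "w \<in> sobolev_space (\<sigma> + 2 * \<alpha>)" using m by (intro S_sobolev[OF N w]) auto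
    have d1: "u - w \<in> sobolev_space (\<sigma> + 2 * \<alpha>)" by (rule sobolev_diff(1)[OF u1 w'])
    have d0: "u - w \<in> sobolev_space (2 * \<alpha>)" using \<sigma> by (intro sobolev_mono(1)[OF d1]) auto
    have "dnorm N (V (u - w)) \<le> K * (sobolev_norm 0 (V (u - w)) + h N powr \<sigma> * sobolev_norm \<sigma> (V (u - w)))"
      by (intro K N V_sobolev d1)
    also have "\<dots> \<le> K * (c0 * (a0 * e) + c1 * (a1 * e))"
    proof (intro mult_left_mono add_mono K)
      show "sobolev_norm 0 (V (u - w)) \<le> c0 * (a0 * e)"
        using c0(2)[OF d0] mult_left_mono[OF w0 c0(1)] by linarith
      have "h N powr \<sigma> * sobolev_norm \<sigma> (V (u - w)) \<le> h N powr \<sigma> * (c1 * sobolev_norm (\<sigma> + 2 * \<alpha>) (u - w))"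
        by (intro mult_left_mono c1(2) d1) auto
      also have "\<dots> = c1 * (h N powr \<sigma> * sobolev_norm (\<sigma> + 2 * \<alpha>) (u - w))" by (simp only: mult_ac)
      also have "\<dots> \<le> c1 * (a1 * e)" by (rule mult_left_mono[OF w1 c1(1)])
      finally show "h N powr \<sigma> * sobolev_norm \<sigma> (V (u - w)) \<le> c1 * (a1 * e)" .
    qed
    finally have D: "dnorm N (V (u - w)) \<le> K * (c0 * a0 + c1 * a1) * e"
      by (simp add: algebra_simps)
    note v' = v[unfolded B(2) iff] and w_in = w[unfolded B(2)]
    have "wnorm (point_weight (x N)) {1..M N} (samples N (v - w)) \<le>
        wnorm (point_weight (x N)) {1..M N} (\<lambda>j. samples N u j - samples N w j)"
      by (rule minimiser_quasi_optimal[OF B(1) lin conjunct1[OF v'] bspec[OF conjunct2[OF v']] w_in])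
    also have "(\<lambda>j. samples N u j - samples N w j) = samples N (u - w)"
      using point_value_linear(2)[OF V_sobolev[OF u1] V_sobolev[OF w'] \<sigma>(1)]
      by (simp add: samples_def[abs_def] V_linear)
    finally have "dnorm N (V (v - w)) \<le> K * (c0 * a0 + c1 * a1) * e"
      using D by (simp add: dnorm_V)
    moreover have "v - w \<in> S N" using vS w unfolding B(2) by (rule pdist.span_diff)
    ultimately have vw: "sobolev_norm (2 * \<alpha>) (v - w) \<le> c * (K * (c0 * a0 + c1 * a1) * e)"
      by (intro order_trans[OF c(2)[rule_format] mult_left_mono[OF _ c(1)]])
    have "v - w \<in> sobolev_space (2 * \<alpha>)"
      using \<open>v - w \<in> S N\<close> m by (intro S_sobolev[OF N]) auto
    from sobolev_diff(2)[OF this d0] have "sobolev_norm (2 * \<alpha>) (v - u) \<le> sobolev_norm (2 * \<alpha>) (v - w) + sobolev_norm (2 * \<alpha>) (u - w)"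
      by simp
    also have "\<dots> \<le> c * (K * (c0 * a0 + c1 * a1) * e) + a0 * e"
      by (intro add_mono vw w0)
    also have "\<dots> \<le> (c + 1) * A * e"
    proof -
      have "0 \<le> K * (c0 * a0 + c1 * a1) * e" "0 \<le> c * (a0 * e)" using A e c by auto
      then show ?thesis unfolding A_def by (simp add: distrib_right distrib_left mult.assoc)
    qed
    finally show ?thesis by (simp add: e_def mult.assoc)
  qed
  have "A \<ge> 0" using A by (simp add: A_def)
  then show ?thesis by (intro exI[of _ A] conjI allI impI ballI main) auto
qed

text \<open>From \<open>N0\<close> on the constant of \<open>coercive\<close> works. Each smaller N
  adds at most one more constant, and a maximum of finitely many is still independent of N and
  u.\<close>

lemma convergence:
  "\<exists>C>0.
    (\<forall>\<^sub>F N in sequentially. \<forall>u\<in>sobolev_space l.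
      \<exists>!v. least_squares_collocation V (S N) (M N) (x N) (V u) v) \<and>
    (\<forall>N\<ge>1. \<forall>u\<in>sobolev_space l.
      (\<exists>!v. least_squares_collocation V (S N) (M N) (x N) (V u) v) \<longrightarrow>
      (\<forall>v. least_squares_collocation V (S N) (M N) (x N) (V u) v \<longrightarrow>
        sobolev_norm (2 * \<alpha>) (v - u) \<le> C * h N powr (l - 2 * \<alpha>) * sobolev_norm l u))"
proof -
  obtain c where c: "c \<ge> 0" "\<forall>\<^sub>F N in sequentially. \<forall>w\<in>S N. sobolev_norm (2 * \<alpha>) w \<le> c * dnorm N (V w)"
    using coercive by blast
  then obtain N0 where N0: "\<And>N w. N \<ge> N0 \<Longrightarrow> w \<in> S N \<Longrightarrow> sobolev_norm (2 * \<alpha>) w \<le> c * dnorm N (V w)"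
    by (auto simp: eventually_sequentially)
  define P where "P N c \<longleftrightarrow> (\<forall>w\<in>S N. sobolev_norm (2 * \<alpha>) w \<le> c * dnorm N (V w))" for N c
  \<comment> \<open>For an N without such a constant the choice is arbitrary and can at most enlarge
    the maximum; \<open>P N (d N)\<close> is invoked only under unique solvability.\<close>
  define d where "d N = (SOME c. c \<ge> 0 \<and> P N c)" for N
  define C0 where "C0 = Max (insert c (d ` {..<N0}))"
  have C0: "c \<le> C0" "N < N0 \<Longrightarrow> d N \<le> C0" for N
    unfolding C0_def by (auto intro!: Max_ge)
  have P: "P N C0" if N: "N \<ge> 1"
    and ex1: "\<exists>!v. least_squares_collocation V (S N) (M N) (x N) (V u) v" for N u
  proof -
    obtain c' where c': "P N c'" "c' \<le> C0"
    proof (cases "N \<ge> N0")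
      case True
      then show ?thesis using that[of c] N0 C0 by (auto simp: P_def)
    next
      case False
      have "\<exists>c. c \<ge> 0 \<and> P N c" using unique_imp_bounded[OF N ex1] by (auto simp: P_def)
      from someI_ex[OF this] have "P N (d N)" unfolding d_def by blast
      with False C0(2)[of N] that show ?thesis by auto
    qed
    show ?thesis
      unfolding P_def
    proof
      fix w assume "w \<in> S N"
      then have "sobolev_norm (2 * \<alpha>) w \<le> c' * dnorm N (V w)" using c'(1) by (simp add: P_def)
      also have "\<dots> \<le> C0 * dnorm N (V w)"
        using c'(2) by (intro mult_right_mono) (auto simp: discrete_norm_def)
      finally show "sobolev_norm (2 * \<alpha>) w \<le> C0 * dnorm N (V w)" .
    qed
  qed
  from error_bound obtain A where A: "A \<ge> 0"
    "\<forall>N\<ge>1. \<forall>c\<ge>0. P N c \<longrightarrow> (\<forall>u\<in>sobolev_space l. \<forall>v.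
      least_squares_collocation V (S N) (M N) (x N) (V u) v \<longrightarrow>
      sobolev_norm (2 * \<alpha>) (v - u) \<le> (c + 1) * A * h N powr (l - 2 * \<alpha>) * sobolev_norm l u)"
    unfolding P_def by (elim exE conjE)
  \<comment> \<open>The added 1 makes \<open>C\<close> positive even if
    \<open>A = 0\<close>.\<close>
  define C where "C = (C0 + 1) * A + 1"
  have "C0 \<ge> 0" using c(1) C0(1) by simp
  have estimate: "sobolev_norm (2 * \<alpha>) (v - u) \<le> C * h N powr (l - 2 * \<alpha>) * sobolev_norm l u"
    if "N \<ge> 1" "u \<in> sobolev_space l" "\<exists>!v. least_squares_collocation V (S N) (M N) (x N) (V u) v"
      "least_squares_collocation V (S N) (M N) (x N) (V u) v" for N u v
  proof -
    have "sobolev_norm (2 * \<alpha>) (v - u) \<le> (C0 + 1) * A * h N powr (l - 2 * \<alpha>) * sobolev_norm l u"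
      by (rule A(2)[rule_format, OF that(1) \<open>C0 \<ge> 0\<close> P[OF that(1,3)] that(2,4)])
    also have "\<dots> \<le> C * h N powr (l - 2 * \<alpha>) * sobolev_norm l u"
      by (intro mult_right_mono) (auto simp: C_def)
    finally show ?thesis .
  qed
  have solvable: "\<forall>\<^sub>F N in sequentially. \<forall>u\<in>sobolev_space l.
      \<exists>!v. least_squares_collocation V (S N) (M N) (x N) (V u) v"
    using eventually_ge_at_top[of "max N0 1"]
    by eventually_elim (auto intro!: unique_solvability N0)
  have "C > 0"
  proof -
    have "0 \<le> (C0 + 1) * A" using \<open>C0 \<ge> 0\<close> A(1) by simp
    then show ?thesis by (simp add: C_def)
  qed
  then show ?thesis by (intro exI[of _ C] conjI allI impI ballI solvable estimate)
qed

end

text \<open>For the finitely many N outside the first part the estimate is conditional on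
  uniqueness: otherwise multiples of a nonzero element of \<open>S N\<close> with vanishing samples
  could be added to a minimiser, and no bound could hold for all of them. \<open>C\<close> is chosen
  before N and u.\<close>

theorem theorem1:
  fixes \<alpha> l m r s :: real
    and V :: "pdist \<Rightarrow> pdist"
    and S :: "nat \<Rightarrow> pdist set"
    and h \<E> :: "nat \<Rightarrow> real"
    and M :: "nat \<Rightarrow> nat"
    and x :: "nat \<Rightarrow> nat \<Rightarrow> real"
  assumes "sobolev_isomorphism \<alpha> V"
    and "boundary_element_spaces m h S"
    and "approximation_property l m h S"
    and "inverse_property m h S"
    (* u in H^l has data V u in H^(l - 2 alpha), which is sampled pointwise *)
    and "l - 2 * \<alpha> > 1/2"
    and "\<forall>N\<ge>1. N \<le> M N \<and> collocation_points (M N) (x N)"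
    and "r > 0" and "s > 0" and "max r s < m + 1/2 - 2 * \<alpha>"
    and "\<forall>N\<ge>1. \<E> N > 0"
    and "\<forall>N\<ge>1. \<forall>f\<in>sobolev_space (max r s). \<forall>g\<in>sobolev_space (max r s).
      cmod (l2_pairing g f - discrete_pairing (M N) (x N) g f)
        \<le> \<E> N * (sobolev_norm r f * sobolev_norm s g + sobolev_norm s f * sobolev_norm r g)"
    and "(\<lambda>N. \<E> N * h N powr (- (r + s))) \<longlonglongrightarrow> 0"
  shows "\<exists>C>0.
    (\<forall>\<^sub>F N in sequentially. \<forall>u\<in>sobolev_space l.
      \<exists>!v. least_squares_collocation V (S N) (M N) (x N) (V u) v) \<and>
    (\<forall>N\<ge>1. \<forall>u\<in>sobolev_space l.
      (\<exists>!v. least_squares_collocation V (S N) (M N) (x N) (V u) v) \<longrightarrow>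
      (\<forall>v. least_squares_collocation V (S N) (M N) (x N) (V u) v \<longrightarrow>
        sobolev_norm (2 * \<alpha>) (v - u) \<le> C * h N powr (l - 2 * \<alpha>) * sobolev_norm l u))"
proof -
  interpret collocation_setting \<alpha> l m r s V S h \<E> M x
    by unfold_locales (fact assms)+
  show ?thesis by (rule convergence)
qed

end
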